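(* Let $n\geq 2$ and let $K\subset\mathbb{C}^n$ be a convex body such that for every complex affine hyperplane $H\subset\mathbb{C}^n$, the section $H\cap K$ is symmetric. Then $K$ is a (complex) ellipsoid.
   Context: A convex body is a compact convex subset of $\mathbb{C}^n$ with nonempty interior. $\mathbb{S}^1=\{\xi\in\mathbb{C}:|\xi|=1\}$. A set $A\subset\mathbb{C}^n$ is called symmetric if there is a translated copy $A'=A-x_0$ of $A$ such that $\xi A'=A'$ for every $\xi\in\mathbb{S}^1$ (the empty set and single points are symmetric). A (complex) ellipsoid in $\mathbb{C}^n$ is the image of the closed Euclidean unit ball under an invertible complex affine map. Hyperplanes are complex hyperplanes (complex dimension $n-1$). *)

theory Defs
  imports "HOL-Analysis.Analysis"
begin

definition convex_body :: "(complex ^ 'n) set \<Rightarrow> bool" where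
  "convex_body K \<longleftrightarrow> compact K \<and> convex K \<and> interior K \<noteq> {}"

definition circ_symmetric :: "(complex ^ 'n) set \<Rightarrow> bool" where
  "circ_symmetric A \<longleftrightarrow>
     (\<exists>x0. \<forall>\<xi>::complex. norm \<xi> = 1 \<longrightarrow>
        (\<lambda>x. \<xi> *s x) ` ((\<lambda>x. x - x0) ` A) = (\<lambda>x. x - x0) ` A)"

definition complex_hyperplane :: "(complex ^ 'n) set \<Rightarrow> bool" where
  "complex_hyperplane H \<longleftrightarrow>
     (\<exists>a c. a \<noteq> 0 \<and> H = {x. (\<Sum>i\<in>UNIV. a $ i * x $ i) = c})"

definition complex_ellipsoid :: "(complex ^ 'n) set \<Rightarrow> bool" where
  "complex_ellipsoid E \<longleftrightarrow>
     (\<exists>(M::complex ^ 'n ^ 'n) b. invertible M \<and> E = (\<lambda>x. M *v x + b) ` cball 0 1)"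

end

theory Submission
  imports Defs
begin

text \<open>
  Every complex line \<open>A\<close> meets \<open>K\<close> in a disc. Let \<open>S = A \<inter> K\<close> and let \<open>T\<close> be the compact convex set of all \<open>x\<close>
  with \<open>x + \<xi> (S - S) / 2 \<subseteq> K\<close> for every unit \<open>\<xi>\<close>. If \<open>T\<close> missed \<open>A\<close>, a real hyperplane separating them would
  contain a complex hyperplane \<open>H\<close> through \<open>A\<close>, yet the centre of \<open>H \<inter> K\<close> lies in \<open>T\<close>. So some \<open>x \<in> A\<close> has
  \<open>x + \<xi> (S - S) / 2 \<subseteq> S\<close>, which forces \<open>S\<close> to be the disc around \<open>x\<close> with the diameter of \<open>S\<close>.

  Apply an affine map so that the unit ball is an ellipsoid of maximal volume in \<open>K\<close>, and let \<open>C\<close> be the set of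
  points of the sphere on the boundary of \<open>K\<close>. On the line through two points of \<open>C\<close>, the disc cut
  from \<open>K\<close> contains the disc cut from the ball and touches it at two boundary points, so the discs agree:
  \<open>C\<close> contains the whole circle (chain) in which this line meets the sphere. Maximality prevents \<open>C\<close> from
  lying in a complex hyperplane. A chain-closed subset of the sphere that spans is the whole sphere; this is
  seen on the null cone of the Hermitian form of signature \<open>(n, 1)\<close> in homogeneous coordinates. Hence \<open>K\<close> is
  the ball.
\<close>

section \<open>Sections by complex lines\<close>

definition cinner :: "complex ^ 'n \<Rightarrow> complex ^ 'n \<Rightarrow> complex" where
  "cinner x y = (\<Sum>i\<in>UNIV. x $ i * cnj (y $ i))"

lemma cinner_add_left: "cinner (x + y) z = cinner x z + cinner y z"
  by (simp add: cinner_def sum.distrib algebra_simps)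

lemma cinner_diff_left: "cinner (x - y) z = cinner x z - cinner y z"
  by (simp add: cinner_def sum_subtractf algebra_simps)

lemma cinner_scale_left: "cinner (c *s x) z = c * cinner x z"
  by (simp add: cinner_def sum_distrib_left algebra_simps)

lemma cinner_commute: "cinner y x = cnj (cinner x y)"
  by (simp add: cinner_def mult.commute)

lemma cinner_diff_right: "cinner x (y - z) = cinner x y - cinner x z"
  by (simp add: cinner_def sum_subtractf algebra_simps)

lemma Re_cinner: "Re (cinner x y) = x \<bullet> y"
  by (simp add: cinner_def inner_vec_def inner_complex_def)

lemma cinner_self: "cinner x x = of_real ((norm x)\<^sup>2)"
proof (rule complex_eqI)
  show "Re (cinner x x) = Re (of_real ((norm x)\<^sup>2))"
    by (simp add: Re_cinner power2_norm_eq_inner)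
  have "Im (cinner x x) = - Im (cinner x x)"
    by (subst cinner_commute) simp
  then show "Im (cinner x x) = Im (of_real ((norm x)\<^sup>2))"
    by simp
qed

lemma scaleR_eq_vector_mult: "r *\<^sub>R x = complex_of_real r *s (x :: complex ^ 'n)"
  by (simp add: vec_eq_iff scaleR_conv_of_real[where 'a = complex])

lemma norm_vector_mult: "norm (c *s x) = cmod c * norm (x :: complex ^ 'n)"
  by (simp add: norm_vec_def norm_mult L2_set_right_distrib)

lemma bounded_linear_vector_mult_left: "bounded_linear (\<lambda>c. c *s (x :: complex ^ 'n))"
  by (rule bounded_linear_intro[where K = "norm x"])
    (auto simp: vec_eq_iff algebra_simps norm_vector_mult)

text \<open>Averaging the rotation of \<open>y\<close> about the centre by \<xi> with that of
  \<open>z\<close> by -\<xi> leaves one copy of the centre plus \<xi>(y - z)/2. This consequence of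
  symmetry involves only differences of points, so it restricts to a line in \<open>H\<close> that
  may miss the centre.\<close>

lemma symmetric_section_center:
  fixes K :: "(complex ^ 'n) set"
  assumes "convex K" "complex_hyperplane H" "circ_symmetric (H \<inter> K)"
  obtains c where "\<And>y z \<xi>. \<lbrakk>y \<in> H \<inter> K; z \<in> H \<inter> K; cmod \<xi> = 1\<rbrakk> \<Longrightarrow> c + (\<xi> / 2) *s (y - z) \<in> H \<inter> K"
proof -
  obtain a b where H: "H = {x. (\<Sum>i\<in>UNIV. a $ i * x $ i) = b}"
    using assms(2) unfolding complex_hyperplane_def by blast
  have "convex H"
    unfolding convex_def
  proof (intro ballI allI impI)
    fix x y and u v :: real assume *: "x \<in> H" "y \<in> H" "u + v = 1"
    have "(\<Sum>i\<in>UNIV. a $ i * (u *\<^sub>R x + v *\<^sub>R y) $ i)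
        = of_real u * (\<Sum>i\<in>UNIV. a $ i * x $ i) + of_real v * (\<Sum>i\<in>UNIV. a $ i * y $ i)"
      unfolding sum_distrib_left sum.distrib[symmetric]
      by (intro sum.cong refl) (simp add: scaleR_conv_of_real[where 'a = complex] algebra_simps)
    also have "\<dots> = of_real (u + v) * b"
      using *(1,2) by (simp add: H distrib_right)
    finally show "u *\<^sub>R x + v *\<^sub>R y \<in> H"
      using *(3) by (simp add: H)
  qed
  then have conv: "convex (H \<inter> K)"
    using assms(1) by (simp add: convex_Int)
  obtain c where c: "\<And>\<xi>. cmod \<xi> = 1 \<Longrightarrow>
      (\<lambda>x. \<xi> *s x) ` ((\<lambda>x. x - c) ` (H \<inter> K)) = (\<lambda>x. x - c) ` (H \<inter> K)"
    using assms(3) unfolding circ_symmetric_def by blast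
  have rot: "c + \<xi> *s (y - c) \<in> H \<inter> K" if "y \<in> H \<inter> K" "cmod \<xi> = 1" for y \<xi>
  proof -
    have "\<xi> *s (y - c) \<in> (\<lambda>x. x - c) ` (H \<inter> K)"
      using that c[of \<xi>] by blast
    then show ?thesis by (auto simp: algebra_simps)
  qed
  show thesis
  proof (rule that)
    fix y z \<xi> assume *: "y \<in> H \<inter> K" "z \<in> H \<inter> K" "cmod \<xi> = 1"
    have "(1/2) *\<^sub>R (c + \<xi> *s (y - c)) + (1/2) *\<^sub>R (c + (-\<xi>) *s (z - c)) \<in> H \<inter> K"
      using rot[of y \<xi>] rot[of z "-\<xi>"] * by (intro convexD[OF conv]) auto
    also have "(1/2) *\<^sub>R (c + \<xi> *s (y - c)) + (1/2) *\<^sub>R (c + (-\<xi>) *s (z - c)) = c + (\<xi> / 2) *s (y - z)"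
      by (simp add: vec_eq_iff scaleR_conv_of_real[where 'a = complex] field_simps)
    finally show "c + (\<xi> / 2) *s (y - z) \<in> H \<inter> K" .
  qed
qed

lemma exists_orthogonal:
  fixes d :: "complex ^ 'n"
  assumes "CARD('n) \<ge> 2"
  obtains a where "a \<noteq> 0" "cinner d a = 0"
proof -
  obtain i j :: 'n where ij: "i \<noteq> j"
    using assms by (metis card_2_iff' ex_card subset_UNIV)
  show thesis
  proof (cases "d $ i = 0")
    case True
    have "cinner d (axis i 1) = 0"
      unfolding cinner_def by (intro sum.neutral) (auto simp: axis_def True)
    then show thesis using that[of "axis i 1"] by (simp add: axis_eq_0_iff)
  next
    case False
    let ?a = "axis i (cnj (d $ j)) - axis j (cnj (d $ i)) :: complex ^ 'n"
    have "cinner d ?a = (\<Sum>k\<in>UNIV. d $ k * (if k = i then d $ j else 0)) - (\<Sum>k\<in>UNIV. d $ k * (if k = j then d $ i else 0))"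
      unfolding cinner_def sum_subtractf[symmetric] by (intro sum.cong) (auto simp: axis_def)
    also have "\<dots> = 0"
      by (simp add: if_distrib cong: if_cong)
    finally have "cinner d ?a = 0" .
    moreover have "?a $ j \<noteq> 0"
      using ij False by (simp add: axis_def)
    ultimately show thesis using that[of ?a] by (metis zero_index)
  qed
qed

lemma complex_hyperplane_cinner:
  assumes "a \<noteq> 0" shows "complex_hyperplane {x. cinner x a = b}"
  unfolding complex_hyperplane_def
  by (rule exI[of _ "\<chi> i. cnj (a $ i)"], rule exI[of _ b])
    (use assms in \<open>auto simp: cinner_def vec_eq_iff mult.commute\<close>)

text \<open>The numbers \<open>s\<close>, \<open>t\<close> and \<open>c\<close> are coordinates on
  the line through \<open>p\<close> with direction \<open>d\<close>. Centres of hyperplane sections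
  need not lie on this line; convexity of the set \<open>T\<close> of all admissible centres and a
  separation argument produce one that does.\<close>

lemma line_contains_center:
  fixes K :: "(complex ^ 'n) set"
  assumes card: "CARD('n) \<ge> 2" and K: "compact K" "convex K"
    and sym: "\<And>H. complex_hyperplane H \<Longrightarrow> circ_symmetric (H \<inter> K)"
    and pK: "p \<in> K"
  obtains c where "\<And>s t \<xi>. \<lbrakk>p + s *s d \<in> K; p + t *s d \<in> K; cmod \<xi> = 1\<rbrakk> \<Longrightarrow>
     p + (c + (\<xi> / 2) * (s - t)) *s d \<in> K"
proof -
  \<comment> \<open>As an intersection of translates of \<open>K\<close>, this set is closed and
    convex. The shift 0 occurs among them because \<open>p\<close> lies in \<open>K\<close>, which
    puts \<open>T\<close> inside \<open>K\<close>.\<close>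
  define T where "T = (\<Inter>g\<in>{((\<xi> / 2) * (s - t)) *s d | \<xi> s t. cmod \<xi> = 1 \<and> p + s *s d \<in> K \<and> p + t *s d \<in> K}. (\<lambda>x. x + g) -` K)"
  have T_mem: "x \<in> T \<longleftrightarrow> (\<forall>\<xi> s t. cmod \<xi> = 1 \<longrightarrow> p + s *s d \<in> K \<longrightarrow> p + t *s d \<in> K \<longrightarrow> x + ((\<xi> / 2) * (s - t)) *s d \<in> K)" for x
    unfolding T_def by blast
  have "closed T"
    unfolding T_def
    by (intro closed_INT ballI continuous_closed_vimage compact_imp_closed[OF K(1)]) (auto intro: continuous_intros)
  moreover have TK: "T \<subseteq> K"
  proof
    fix x assume "x \<in> T"
    then have "x + ((1 / 2) * (0 - 0)) *s d \<in> K"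
      unfolding T_mem using pK by (metis add.right_neutral norm_one vector_smult_lzero)
    then show "x \<in> K" by simp
  qed
  ultimately have "compact T"
    using K(1) by (metis closed_Int_compact inf.absorb_iff1 inf.absorb1)
  have "convex T"
    unfolding T_def
  proof (intro convex_INT)
    fix g :: "complex ^ 'n"
    show "convex ((\<lambda>x. x + g) -` K)"
    proof -
      have "(\<lambda>x. x + g) -` K = (\<lambda>x. x - g) ` K"
        by (force simp: image_iff algebra_simps)
      then show ?thesis using K(2) by (metis convex_translation_subtract_eq)
    qed
  qed
  \<comment> \<open>The condition \<open>cinner d a = 0\<close> puts the whole line into the
    hyperplane, so chords of the line section are chords of the hyperplane section, and the centre
    of the latter lies in \<open>T\<close>.\<close>
  have center: "\<exists>c\<in>T. cinner c a = cinner p a" if a: "a \<noteq> 0" "cinner d a = 0" for a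
  proof -
    let ?H = "{x. cinner x a = cinner p a}"
    have H: "complex_hyperplane ?H" using a(1) by (rule complex_hyperplane_cinner)
    obtain c where c: "\<And>y z \<xi>. \<lbrakk>y \<in> ?H \<inter> K; z \<in> ?H \<inter> K; cmod \<xi> = 1\<rbrakk> \<Longrightarrow> c + (\<xi> / 2) *s (y - z) \<in> ?H \<inter> K"
      using symmetric_section_center[OF K(2) H sym[OF H]] by blast
    have "c \<in> ?H"
      using c[of p p 1] pK by simp
    moreover have "c \<in> T"
      unfolding T_mem
    proof (intro allI impI)
      fix \<xi> s t assume *: "cmod \<xi> = 1" "p + s *s d \<in> K" "p + t *s d \<in> K"
      have "c + (\<xi> / 2) *s ((p + s *s d) - (p + t *s d)) \<in> K"
        using c[of "p + s *s d" "p + t *s d" \<xi>] * a(2) by (simp add: cinner_add_left cinner_scale_left)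
      also have "(\<xi> / 2) *s ((p + s *s d) - (p + t *s d)) = ((\<xi> / 2) * (s - t)) *s d"
        by (simp add: vec_eq_iff algebra_simps)
      finally show "c + ((\<xi> / 2) * (s - t)) *s d \<in> K" .
    qed
    ultimately show ?thesis by blast
  qed
  have "T \<noteq> {}"
    using exists_orthogonal[OF card, of d] center by blast
  define A where "A = range (\<lambda>s. p + s *s d)"
  have "\<exists>x \<in> T. x \<in> A"
  proof (rule ccontr)
    assume "\<not> ?thesis"
    then have disj: "T \<inter> A = {}" by blast
    have A_eq: "A = (+) p ` range (\<lambda>s. s *s d)"
      by (auto simp: A_def)
    have sub: "subspace (range (\<lambda>s. s *s d))"
      by (rule linear_subspace_image) (auto intro: bounded_linear.linear bounded_linear_vector_mult_left)
    have "closed A" "convex A"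
      unfolding A_eq using closed_subspace[OF sub] subspace_imp_convex[OF sub]
      by (auto intro!: closed_translation convex_translation)
    then obtain a b where ab: "\<And>x. x \<in> T \<Longrightarrow> a \<bullet> x < b" "\<And>x. x \<in> A \<Longrightarrow> b < a \<bullet> x"
      using separating_hyperplane_compact_closed[OF \<open>convex T\<close> \<open>compact T\<close> \<open>T \<noteq> {}\<close>] disj by metis
    have "a \<noteq> 0"
    proof
      assume "a = 0"
      moreover obtain t where "t \<in> T" using \<open>T \<noteq> {}\<close> by blast
      moreover have "p \<in> A" unfolding A_def by (rule image_eqI[of _ _ 0]) auto
      ultimately show False using ab(1)[of t] ab(2)[of p] by simp
    qed
    have lin: "b < Re (cinner p a + s * cinner d a)" for s
    proof -
      have "b < (p + s *s d) \<bullet> a"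
        using ab(2)[of "p + s *s d"] unfolding A_def by (auto simp: inner_commute)
      then show ?thesis
        by (simp only: Re_cinner[symmetric] cinner_add_left cinner_scale_left)
    qed
    \<comment> \<open>The bound \<open>lin\<close> holds for all complex \<open>s\<close>. With a
      nonzero coefficient, some \<open>s\<close> would give the value \<open>b\<close> itself; hence
      the separating functional is constant on the line even as a complex functional.\<close>
    have "cinner d a = 0"
    proof (rule ccontr)
      assume "cinner d a \<noteq> 0"
      then show False
        using lin[of "(of_real b - cinner p a) / cinner d a"] by simp
    qed
    then obtain c where c: "c \<in> T" "cinner c a = cinner p a"
      using center \<open>a \<noteq> 0\<close> by blast
    then have "a \<bullet> c = a \<bullet> p"
      by (metis Re_cinner inner_commute)
    moreover have "p \<in> A" unfolding A_def by (rule image_eqI[of _ _ 0]) auto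
    ultimately show False
      using ab(1)[OF c(1)] ab(2)[of p] by simp
  qed
  then obtain c where c: "p + c *s d \<in> T"
    by (auto simp: A_def)
  show thesis
    using c unfolding T_mem by (intro that[of c]) (simp add: vector_sadd_rdistrib add.assoc)
qed

section \<open>From symmetric differences to discs\<close>

text \<open>Turning a diametral chord shows that \<open>S\<close> contains the disc about
  \<open>c\<close> whose radius is half the diameter. A point of \<open>S\<close> outside it would
  be farther than the diameter from the opposite point of the boundary circle, so \<open>S\<close>
  is this disc.\<close>

lemma diametral_section_circular:
  fixes S :: "complex set"
  assumes "compact S" "convex S"
    and c: "\<And>s t \<xi>. \<lbrakk>s \<in> S; t \<in> S; cmod \<xi> = 1\<rbrakk> \<Longrightarrow> c + (\<xi> / 2) * (s - t) \<in> S"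
    and "s \<in> S" "cmod \<xi> = 1"
  shows "c + \<xi> * (s - c) \<in> S"
proof -
  define r where "r = diameter S / 2"
  obtain u v where uv: "u \<in> S" "v \<in> S" "dist u v = diameter S"
    using diameter_compact_attained[OF assms(1)] assms(4) by blast
  have circ: "c + of_real r * \<zeta> \<in> S" if "cmod \<zeta> = 1" for \<zeta>
  proof (cases "u = v")
    case True
    then have "r = 0" using uv(3) by (simp add: r_def)
    then show ?thesis using c[OF uv(1) uv(1), of 1] by simp
  next
    case False
    have "c + (\<zeta> * (of_real (cmod (u - v)) / (u - v)) / 2) * (u - v) \<in> S"
      using False that by (intro c uv) (auto simp: norm_mult norm_divide)
    also have "c + (\<zeta> * (of_real (cmod (u - v)) / (u - v)) / 2) * (u - v) = c + of_real r * \<zeta>"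
      using False uv(3) by (simp add: r_def dist_norm field_simps)
    finally show ?thesis .
  qed
  have "r \<ge> 0" by (simp add: r_def diameter_ge_0 compact_imp_bounded assms)
  have disc: "c + z \<in> S" if "cmod z \<le> r" for z
  proof (cases "z = 0")
    case True
    then show ?thesis using c[OF uv(1) uv(1), of 1] by simp
  next
    case False
    then have r: "r > 0" using that by (smt (verit) zero_less_norm_iff)
    define \<zeta> where "\<zeta> = z / of_real (cmod z)"
    \<comment> \<open>The weight at which the diameter with end points c + r\<zeta> and c - r\<zeta>
      passes through c + z.\<close>
    define a where "a = (1 + cmod z / r) / 2"
    have "a *\<^sub>R (c + of_real r * \<zeta>) + (1 - a) *\<^sub>R (c + of_real r * (- \<zeta>)) \<in> S"
      using False that r by (intro convexD[OF assms(2)] circ) (auto simp: a_def \<zeta>_def norm_divide field_simps)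
    also have "a *\<^sub>R (c + of_real r * \<zeta>) + (1 - a) *\<^sub>R (c + of_real r * (- \<zeta>)) = c + z"
      using False r by (simp add: a_def \<zeta>_def scaleR_conv_of_real field_simps)
    finally show ?thesis .
  qed
  have "cmod (s - c) \<le> r"
  proof (cases "s = c")
    case False
    define \<zeta> where "\<zeta> = (c - s) / of_real (cmod (c - s))"
    have "c + of_real r * \<zeta> \<in> S" using False by (intro circ) (auto simp: \<zeta>_def norm_divide)
    then have "dist s (c + of_real r * \<zeta>) \<le> diameter S"
      using assms(1,4) by (intro diameter_bounded_bound compact_imp_bounded)
    moreover have "s - (c + of_real r * \<zeta>) = - of_real (cmod (c - s) + r) * \<zeta>"
      using False by (simp add: \<zeta>_def field_simps)
    then have "dist s (c + of_real r * \<zeta>) = cmod (c - s) + r"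
      using False \<open>r \<ge> 0\<close> unfolding dist_norm by (simp add: norm_mult \<zeta>_def norm_divide del: of_real_add)
    ultimately show ?thesis by (simp add: r_def norm_minus_commute)
  qed (use \<open>r \<ge> 0\<close> in auto)
  then show ?thesis
    using assms(5) by (intro disc) (simp add: norm_mult)
qed

text \<open>For compact convex \<open>K\<close> and nonzero \<open>d\<close>, this says that the
  section is a disc, a point or empty. Rotating the parameter of the line instead of points makes
  the property visibly invariant under affine maps.\<close>

definition disc_sections :: "(complex ^ 'n) set \<Rightarrow> bool" where
  "disc_sections K \<longleftrightarrow> (\<forall>p d. \<exists>c. \<forall>s \<xi>. cmod \<xi> = 1 \<longrightarrow> p + s *s d \<in> K \<longrightarrow> p + (c + \<xi> * (s - c)) *s d \<in> K)"

lemma disc_sections_if_symmetric_hyperplane_sections: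
  fixes K :: "(complex ^ 'n) set"
  assumes card: "CARD('n) \<ge> 2" and K: "compact K" "convex K"
    and sym: "\<And>H. complex_hyperplane H \<Longrightarrow> circ_symmetric (H \<inter> K)"
  shows "disc_sections K"
  unfolding disc_sections_def
proof (intro allI)
  fix p d :: "complex ^ 'n"
  define S where "S = (\<lambda>s. p + s *s d) -` K"
  consider "S = {}" | "d = 0" | s0 where "s0 \<in> S" "d \<noteq> 0" by blast
  then show "\<exists>c. \<forall>s \<xi>. cmod \<xi> = 1 \<longrightarrow> p + s *s d \<in> K \<longrightarrow> p + (c + \<xi> * (s - c)) *s d \<in> K"
  proof cases
    case 3
    \<comment> \<open>\<open>line_contains_center\<close> requires a base point in \<open>K\<close>,
      hence the move from \<open>p\<close> to the point with parameter \<open>s0\<close>.\<close>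
    obtain c0 where c0: "\<And>s t \<xi>. \<lbrakk>(p + s0 *s d) + s *s d \<in> K; (p + s0 *s d) + t *s d \<in> K; cmod \<xi> = 1\<rbrakk> \<Longrightarrow>
       (p + s0 *s d) + (c0 + (\<xi> / 2) * (s - t)) *s d \<in> K"
      using line_contains_center[OF card K sym, of "p + s0 *s d" d] 3(1) unfolding S_def by blast
    have shift: "(p + s0 *s d) + s *s d = p + (s0 + s) *s d" for s
      by (simp add: vector_sadd_rdistrib add.assoc)
    have c: "(s0 + c0) + (\<xi> / 2) * (s - t) \<in> S" if "s \<in> S" "t \<in> S" "cmod \<xi> = 1" for s t \<xi>
      using c0[of "s - s0" "t - s0" \<xi>] that unfolding S_def shift by (simp add: algebra_simps)
    have cont: "continuous_on UNIV (\<lambda>s. p + s *s d)"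
      by (intro continuous_intros linear_continuous_on bounded_linear_vector_mult_left)
    have "closed S"
      unfolding S_def using cont K(1) by (intro continuous_closed_vimage) (auto simp: compact_imp_closed continuous_on_eq_continuous_at)
    moreover have "bounded S"
    proof -
      obtain B where B: "\<And>x. x \<in> K \<Longrightarrow> norm x \<le> B"
        using compact_imp_bounded[OF K(1)] unfolding bounded_iff by blast
      have "cmod s \<le> (B + norm p) / norm d" if "s \<in> S" for s
      proof -
        have "cmod s * norm d = norm ((p + s *s d) - p)" by (simp add: norm_vector_mult)
        also have "\<dots> \<le> norm (p + s *s d) + norm p" by (rule norm_triangle_ineq4)
        also have "\<dots> \<le> B + norm p" using B[of "p + s *s d"] that by (simp add: S_def)
        finally show ?thesis using 3(2) by (simp add: field_simps)
      qed
      then show ?thesis unfolding bounded_iff by blast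
    qed
    ultimately have "compact S" by (simp add: compact_eq_bounded_closed)
    moreover have "convex S"
      unfolding convex_def
    proof (intro ballI allI impI)
      fix x y and u v :: real assume *: "x \<in> S" "y \<in> S" "0 \<le> u" "0 \<le> v" "u + v = 1"
      have "u *\<^sub>R (p + x *s d) + v *\<^sub>R (p + y *s d) \<in> K"
        using * by (intro convexD[OF K(2)]) (auto simp: S_def)
      also have "u *\<^sub>R (p + x *s d) + v *\<^sub>R (p + y *s d) = (u + v) *\<^sub>R p + (u *\<^sub>R x + v *\<^sub>R y) *s d"
        by (simp add: vec_eq_iff algebra_simps)
      finally show "u *\<^sub>R x + v *\<^sub>R y \<in> S" using * by (simp add: S_def)
    qed
    ultimately have "(s0 + c0) + \<xi> * (s - (s0 + c0)) \<in> S" if "s \<in> S" "cmod \<xi> = 1" for s \<xi>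
      using diametral_section_circular[of S "s0 + c0" s \<xi>] c that by blast
    then show ?thesis unfolding S_def by (metis vimage_eq)
  qed (auto simp: S_def)
qed

section \<open>Contact points with an inscribed ball\<close>

text \<open>A hyperplane supporting \<open>K\<close> at \<open>u\<close> also supports the inscribed
  ball there, which leaves \<open>u\<close> as the only possible outer unit normal.\<close>

lemma contact_point_support:
  fixes K :: "(complex ^ 'n) set"
  assumes "convex K" and ball: "cball 0 1 \<subseteq> K" and u: "norm u = 1" "u \<notin> interior K" and "x \<in> K"
  shows "Re (cinner x u) \<le> 1"
proof -
  have "interior K \<noteq> {}"
    using interior_mono[OF ball] by (metis ball_eq_empty interior_cball less_numeral_extra(3) linorder_not_le subset_empty zero_less_one)
  have "u \<in> closure K" using ball u(1) closure_subset by fastforce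
  moreover have "u \<notin> rel_interior K"
    using u(2) \<open>interior K \<noteq> {}\<close> by (simp add: rel_interior_nonempty_interior)
  ultimately obtain a where a: "a \<noteq> 0" "\<And>y. y \<in> closure K \<Longrightarrow> a \<bullet> u \<le> a \<bullet> y"
    using supporting_hyperplane_relative_frontier[OF \<open>convex K\<close>] by metis
  define b where "b = - a /\<^sub>R norm a"
  have b: "norm b = 1" using a(1) by (simp add: b_def)
  have sup: "b \<bullet> y \<le> b \<bullet> u" if "y \<in> K" for y
    using a(2)[of y] that closure_subset[of K] a(1) by (auto simp: b_def mult_left_mono)
  \<comment> \<open>The unit normal \<open>b\<close> is itself a point of the ball; the inequality
    is then the equality case of Cauchy-Schwarz.\<close>
  have "b \<bullet> b \<le> b \<bullet> u"
    using b ball by (intro sup) auto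
  then have "(norm (b - u))\<^sup>2 \<le> 0"
    using b u(1) by (simp add: power2_norm_eq_inner[symmetric] dot_norm_neg field_simps)
  then have "b = u" by simp
  then show ?thesis
    using sup[OF \<open>x \<in> K\<close>] u(1) by (simp add: Re_cinner inner_commute power2_norm_eq_inner[symmetric] flip: power2_norm_eq_inner)
qed

lemma norm_line_sq:
  "(norm (u + s *s d))\<^sup>2 = (norm u)\<^sup>2 + 2 * Re (s * cinner d u) + (cmod s)\<^sup>2 * (norm d)\<^sup>2"
proof -
  have "(norm (u + s *s d))\<^sup>2 = (norm u)\<^sup>2 + 2 * ((s *s d) \<bullet> u) + (norm (s *s d))\<^sup>2"
    by (simp add: power2_norm_eq_inner inner_add_left inner_add_right inner_commute)
  then show ?thesis
    by (simp add: norm_vector_mult power_mult_distrib cinner_scale_left flip: Re_cinner)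
qed

lemma cmod_add_sq: "(cmod (a + b))\<^sup>2 = (cmod a)\<^sup>2 + 2 * Re (a * cnj b) + (cmod b)\<^sup>2"
  unfolding cmod_power2 by (simp add: power2_eq_square algebra_simps)

text \<open>Rotating about \<open>c\<close> the point of the disc farthest from \<open>c\<close>
  yields a circle of radius \<open>\<rho> + cmod c\<close> inside \<open>S\<close>. It respects the
  tangent in a unit direction \<open>e\<close> only if \<open>c\<close> vanishes or points opposite
  to \<open>e\<close>, so two distinct directions force c = 0. Then \<open>S\<close> is invariant
  under rotation about 0 and one tangent bounds it in every direction.\<close>

lemma bounded_by_two_tangents:
  fixes S :: "complex set"
  assumes "\<rho> \<ge> 0" and disc: "\<And>z. cmod z \<le> \<rho> \<Longrightarrow> z \<in> S"
    and rot: "\<And>z \<xi>. \<lbrakk>z \<in> S; cmod \<xi> = 1\<rbrakk> \<Longrightarrow> c + \<xi> * (z - c) \<in> S"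
    and ab: "cmod a = 1" "cmod b = 1" "a \<noteq> b"
    and tangent: "\<And>z. z \<in> S \<Longrightarrow> Re (z * cnj a) \<le> \<rho>" "\<And>z. z \<in> S \<Longrightarrow> Re (z * cnj b) \<le> \<rho>"
    and "z \<in> S"
  shows "cmod z \<le> \<rho>"
proof -
  have circ: "c + of_real (\<rho> + cmod c) * \<xi> \<in> S" if "cmod \<xi> = 1" for \<xi>
  proof (cases "c = 0")
    case True
    then show ?thesis using that assms(1) by (auto intro!: disc simp: norm_mult)
  next
    case False
    define w where "w = - of_real \<rho> * (c / of_real (cmod c))"
    have "w \<in> S" using False assms(1) by (intro disc) (auto simp: w_def norm_mult norm_divide)
    then have "c + (- \<xi> * of_real (cmod c) / c) * (w - c) \<in> S"
      using that False by (intro rot) (auto simp: norm_mult norm_divide)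
    also have "(- \<xi> * of_real (cmod c) / c) * (w - c) = of_real (\<rho> + cmod c) * \<xi>"
      using False by (simp add: w_def field_simps)
    finally show ?thesis .
  qed
  have touch: "c = - of_real (cmod c) * e" if "cmod e = 1" and t: "\<And>z. z \<in> S \<Longrightarrow> Re (z * cnj e) \<le> \<rho>" for e
  proof -
    have ee: "e * cnj e = 1" using that(1) by (simp add: complex_norm_square[symmetric])
    have "Re ((c + of_real (\<rho> + cmod c) * e) * cnj e) \<le> \<rho>" using circ that by blast
    then have le: "Re (c * cnj e) + cmod c \<le> 0"
      by (simp add: distrib_right mult.assoc ee del: complex_cnj_mult times_complex.sel)
    have "(cmod (c + of_real (cmod c) * e))\<^sup>2 = 2 * cmod c * (Re (c * cnj e) + cmod c)"
    proof -
      have "(cmod (c + of_real (cmod c) * e))\<^sup>2 = (cmod c)\<^sup>2 + 2 * cmod c * Re (c * cnj e) + (cmod c * cmod e)\<^sup>2"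
        unfolding cmod_add_sq by (simp add: norm_mult algebra_simps)
      then show ?thesis using that(1) by (simp add: power2_eq_square algebra_simps)
    qed
    also have "\<dots> \<le> 0" using le by (simp add: mult_nonneg_nonpos)
    finally show ?thesis by (simp add: add_eq_0_iff)
  qed
  have "c = 0"
    using touch[OF ab(1) tangent(1)] touch[OF ab(2) tangent(2)] ab(3)
    by (metis mult_cancel_left neg_equal_0_iff_equal norm_eq_zero of_real_eq_0_iff)
  show ?thesis
  proof (cases "z = 0")
    case False
    then have "0 + (a * of_real (cmod z) / z) * (z - 0) \<in> S"
      using rot[OF \<open>z \<in> S\<close>, of "a * of_real (cmod z) / z"] ab(1) \<open>c = 0\<close> by (simp add: norm_mult norm_divide)
    then have "Re (of_real (cmod z) * (a * cnj a)) \<le> \<rho>"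
      using tangent(1) False by (metis add_0 diff_zero mult.assoc mult.commute nonzero_eq_divide_eq)
    then show ?thesis using ab(1) by (simp add: complex_norm_square[symmetric])
  qed (use assms(1) in auto)
qed

lemma contact_points_chain_closed:
  fixes K :: "(complex ^ 'n) set"
  assumes "convex K" and ball: "cball 0 1 \<subseteq> K" and "disc_sections K"
    and u: "norm u = 1" "u \<notin> interior K" and v: "norm v = 1" "v \<notin> interior K"
    and w: "norm (u + s *s (v - u)) = 1"
  shows "u + s *s (v - u) \<notin> interior K"
proof (cases "u = v")
  case True
  then show ?thesis using u by simp
next
  case False
  define d where "d = v - u"
  have d: "norm d > 0" using False by (simp add: d_def)
  \<comment> \<open>The parameter of the point of the line nearest to the origin. The ball cuts out
    the disc of radius \<open>cmod m\<close> about \<open>m\<close>, since \<open>u\<close>, with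
    parameter 0, is on the sphere.\<close>
  define m where "m = - cnj (cinner d u) / of_real ((norm d)\<^sup>2)"
  have du: "cinner d u = - of_real ((norm d)\<^sup>2) * cnj m"
    using d by (simp add: m_def)
  have quad: "(norm (u + t *s d))\<^sup>2 = 1 + (norm d)\<^sup>2 * ((cmod (t - m))\<^sup>2 - (cmod m)\<^sup>2)" for t
  proof -
    have "(cmod (t - m))\<^sup>2 - (cmod m)\<^sup>2 = (cmod t)\<^sup>2 - 2 * Re (t * cnj m)"
      using cmod_add_sq[of t "- m"] by simp
    moreover have "Re (t * cinner d u) = - (norm d)\<^sup>2 * Re (t * cnj m)"
      unfolding du by (simp add: algebra_simps)
    ultimately show ?thesis
      unfolding norm_line_sq using u(1)
      by (simp add: right_diff_distrib mult.commute del: times_complex.sel)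
  qed
  define \<rho> where "\<rho> = cmod m"
  have on_sphere: "cmod (t - m) = \<rho>" if "norm (u + t *s d) = 1" for t
    using quad[of t] that d by (simp add: \<rho>_def)
  have \<rho>1: "cmod (1 - m) = \<rho>"
    using on_sphere[of 1] v(1) by (simp add: d_def)
  have \<rho>: "\<rho> > 0"
    using \<rho>1 by (cases "m = 0") (auto simp: \<rho>_def)
  \<comment> \<open>The section of \<open>K\<close> with parameters shifted by \<open>m\<close>: the
    disc of the ball is now centred at 0, and \<open>u\<close> and \<open>v\<close> sit at -m and 1
    - m, where the two tangents are taken.\<close>
  define S where "S = {z. u + (m + z) *s d \<in> K}"
  obtain c where c: "\<And>t \<xi>. \<lbrakk>cmod \<xi> = 1; u + t *s d \<in> K\<rbrakk> \<Longrightarrow> u + (c + \<xi> * (t - c)) *s d \<in> K"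
    using assms(3) unfolding disc_sections_def by metis
  have dv: "cinner d v = of_real ((norm d)\<^sup>2) * cnj (1 - m)"
  proof -
    have "cinner d v = cinner d u + cinner d d"
      by (simp add: d_def cinner_diff_right)
    then show ?thesis by (simp add: du cinner_self algebra_simps)
  qed
  have bound: "cmod z \<le> \<rho>" if "z \<in> S" for z
  proof (rule bounded_by_two_tangents[where S = S and c = "c - m" and a = "- m / of_real \<rho>" and b = "(1 - m) / of_real \<rho>"])
    show "z \<in> S" if "cmod z \<le> \<rho>" for z
    proof -
      have "(cmod z)\<^sup>2 \<le> (cmod m)\<^sup>2" using that by (simp add: \<rho>_def)
      then have "(norm (u + (m + z) *s d))\<^sup>2 \<le> 1\<^sup>2"
        unfolding quad by (simp add: mult_nonneg_nonpos)
      then have "norm (u + (m + z) *s d) \<le> 1" by (rule power2_le_imp_le) simp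
      then show ?thesis using ball by (auto simp: S_def)
    qed
    show "(c - m) + \<xi> * (z - (c - m)) \<in> S" if "z \<in> S" "cmod \<xi> = 1" for z \<xi>
      using c[of \<xi> "m + z"] that by (simp add: S_def algebra_simps)
    show "cmod (- m / of_real \<rho>) = 1" "cmod ((1 - m) / of_real \<rho>) = 1"
      using \<rho> \<rho>1 by (auto simp: norm_divide \<rho>_def)
    have "(- m) / of_real \<rho> \<noteq> (1 - m) / of_real \<rho>"
      using \<rho> by (subst divide_cancel_right) auto
    then show "- m / of_real \<rho> \<noteq> (1 - m) / of_real \<rho>"
      by simp
    show "Re (z * cnj (- m / of_real \<rho>)) \<le> \<rho>" if "z \<in> S" for z
    proof -
      have "Re (cinner (u + (m + z) *s d) u) \<le> 1"
        using contact_point_support[OF assms(1) ball u] that by (simp add: S_def)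
      then have "(norm d)\<^sup>2 * Re ((m + z) * cnj m) \<ge> 0"
        using u(1) by (simp add: cinner_add_left cinner_scale_left cinner_self du algebra_simps)
      then have "Re ((m + z) * cnj m) \<ge> 0" using d by (simp add: zero_le_mult_iff)
      moreover have "m * cnj m = of_real (\<rho>\<^sup>2)" unfolding \<rho>_def by (rule complex_norm_square[symmetric])
      ultimately have "\<rho>\<^sup>2 + Re (z * cnj m) \<ge> 0" by (simp add: distrib_right del: times_complex.sel)
      then have "- Re (z * cnj m) / \<rho> \<le> \<rho>" using \<rho> by (simp add: field_simps power2_eq_square)
      moreover have "z * cnj (- m / of_real \<rho>) = of_real (- 1 / \<rho>) * (z * cnj m)" by simp
      ultimately show ?thesis by (simp del: times_complex.sel complex_cnj_divide complex_cnj_minus add: Re_complex_of_real)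
    qed
    show "Re (z * cnj ((1 - m) / of_real \<rho>)) \<le> \<rho>" if "z \<in> S" for z
    proof -
      have eq: "u + (m + z) *s d = v + (m + z - 1) *s d"
        by (simp add: d_def vec_eq_iff algebra_simps)
      have "Re (cinner (v + (m + z - 1) *s d) v) \<le> 1"
        using contact_point_support[OF assms(1) ball v, of "u + (m + z) *s d"] that
        unfolding S_def eq[symmetric] by blast
      then have "(norm d)\<^sup>2 * Re ((m + z - 1) * cnj (1 - m)) \<le> 0"
        unfolding cinner_add_left cinner_scale_left cinner_self dv v(1) by (simp add: algebra_simps)
      then have "Re ((m + z - 1) * cnj (1 - m)) \<le> 0" using d by (simp add: mult_le_0_iff)
      moreover have "(1 - m) * cnj (1 - m) = of_real (\<rho>\<^sup>2)" unfolding \<rho>1[symmetric] by (rule complex_norm_square[symmetric])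
      moreover have "(m + z - 1) * cnj (1 - m) = z * cnj (1 - m) - (1 - m) * cnj (1 - m)" by (simp add: algebra_simps)
      ultimately have "Re (z * cnj (1 - m)) \<le> \<rho>\<^sup>2" by (simp del: times_complex.sel complex_cnj_diff)
      then have "Re (z * cnj (1 - m)) / \<rho> \<le> \<rho>" using \<rho> by (simp add: field_simps power2_eq_square)
      moreover have "z * cnj ((1 - m) / of_real \<rho>) = of_real (1 / \<rho>) * (z * cnj (1 - m))" by simp
      ultimately show ?thesis by (simp del: times_complex.sel complex_cnj_divide complex_cnj_diff)
    qed
  qed (use \<rho> that in auto)
  show ?thesis
  proof
    assume "u + s *s (v - u) \<in> interior K"
    then obtain e where e: "e > 0" "ball (u + s *s d) e \<subseteq> K"
      unfolding d_def by (meson mem_interior)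
    have sm: "cmod (s - m) = \<rho>" using on_sphere w by (simp add: d_def)
    \<comment> \<open>An interior point could be pushed radially outwards by the factor 1 +
      \<epsilon>, a displacement of e/2, and would leave the disc that contains
      \<open>S\<close>.\<close>
    define \<epsilon> where "\<epsilon> = e / (2 * \<rho> * norm d)"
    have \<epsilon>: "\<epsilon> > 0" using e \<rho> d by (simp add: \<epsilon>_def)
    have "norm ((of_real \<epsilon> * (s - m)) *s d) < e"
      using e \<rho> d \<epsilon> by (simp add: norm_vector_mult norm_mult sm) (simp add: \<epsilon>_def)
    then have "(u + s *s d) + (of_real \<epsilon> * (s - m)) *s d \<in> K"
      using e(2) by (auto simp: dist_norm)
    then have "of_real (1 + \<epsilon>) * (s - m) \<in> S"
      by (simp add: S_def algebra_simps vector_sadd_rdistrib)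
    then have "(1 + \<epsilon>) * \<rho> \<le> \<rho>"
      using bound[of "of_real (1 + \<epsilon>) * (s - m)"] \<epsilon> sm by (simp add: norm_mult del: of_real_add)
    then show False using \<epsilon> \<rho> by (simp add: algebra_simps mult_le_0_iff)
  qed
qed

section \<open>Ellipsoids of maximal volume\<close>

text \<open>The off-diagonal entries of row \<open>k\<close> are cleared by the other rows, which
  are multiples of unit vectors; a diagonal matrix remains.\<close>

lemma det_scalar_plus_row:
  fixes x :: "'a::field ^ 'n"
  assumes "c \<noteq> 0"
  shows "det (\<chi> i. if i = k then axis k c + x else axis i c) = c ^ (CARD('n) - 1) * (c + x $ k)"
proof -
  define A :: "'a ^ 'n ^ 'n" where "A = (\<chi> i. axis i (if i = k then c + x $ k else c))"
  define y where "y = x - axis k (x $ k)"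
  have row: "row i A = axis i (if i = k then c + x $ k else c)" for i
    by (simp add: A_def row_def vec_eq_iff)
  have "y = (\<Sum>j\<in>UNIV - {k}. (x $ j / c) *s row j A)"
  proof -
    have "(\<Sum>j\<in>UNIV - {k}. (x $ j / c) *s row j A) $ i = y $ i" for i
    proof -
      have "(\<Sum>j\<in>UNIV - {k}. (x $ j / c) *s row j A) $ i = (\<Sum>j\<in>UNIV - {k}. if j = i then x $ i else 0)"
        unfolding sum_component by (intro sum.cong) (use assms in \<open>auto simp: row axis_def\<close>)
      also have "\<dots> = y $ i"
        by (subst sum.delta) (auto simp: y_def axis_def)
      finally show ?thesis .
    qed
    then show ?thesis by (simp add: vec_eq_iff)
  qed
  also have "\<dots> \<in> vec.span {row j A |j. j \<noteq> k}"
    by (intro vec.span_sum vec.span_scale vec.span_base) auto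
  finally have "det (\<chi> i. if i = k then row k A + y else row i A) = det A"
    by (rule det_row_span)
  also have "(\<chi> i. if i = k then row k A + y else row i A) = (\<chi> i. if i = k then axis k c + x else axis i c)"
    unfolding row by (auto simp: vec_eq_iff y_def axis_def)
  also have "det A = (\<Prod>i\<in>UNIV. if i = k then c + x $ k else c)"
    by (subst det_diagonal) (auto simp: A_def axis_def intro!: prod.cong)
  also have "\<dots> = (c + x $ k) * c ^ (CARD('n) - 1)"
    by (subst prod.remove[of _ k]) (auto simp: card_Diff_singleton)
  finally show ?thesis by (simp add: mult.commute)
qed

text \<open>If all contact points lay in one hyperplane, let \<open>g\<close> be an affine function
  vanishing on it and deform the ball by sending x to (1 - t) x + t g(x) e_k. Where |g| < 1 the
  image stays in the ball; the rest is a compact subset of the interior of \<open>K\<close> and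
  tolerates a small displacement. The determinant loses about (n - 1) t by shrinking and gains 2nt
  in direction \<open>k\<close>.\<close>

lemma maximal_ball_contact_points_span:
  fixes K :: "(complex ^ 'n) set"
  assumes ball: "cball 0 1 \<subseteq> K"
    and max: "\<And>M b. (\<And>x. x \<in> cball 0 1 \<Longrightarrow> M *v x + b \<in> K) \<Longrightarrow> cmod (det M) \<le> 1"
    and "a \<noteq> 0"
  shows "\<exists>u. norm u = 1 \<and> u \<notin> interior K \<and> cinner u a \<noteq> c"
proof (rule ccontr)
  assume "\<not> ?thesis"
  then have contact: "cinner u a = c" if "norm u = 1" "u \<notin> interior K" for u
    using that by blast
  obtain k where k: "a $ k \<noteq> 0"
    using \<open>a \<noteq> 0\<close> by (metis vec_eq_iff zero_index)
  define n where "n = CARD('n)"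
  have "n > 0" by (simp add: n_def)
  \<comment> \<open>This gives \<open>g\<close> the slope 2n + 1 along axis \<open>k\<close>, so
    that the diagonal entry there becomes 1 - t + (2n + 1) t = 1 + 2nt.\<close>
  define \<mu> where "\<mu> = of_nat (2 * n + 1) / cnj (a $ k)"
  define g where "g = (\<lambda>x. \<mu> * (cinner x a - c))"
  have cont: "continuous_on S g" for S
    unfolding g_def cinner_def by (intro continuous_intros)
  define W where "W = {x \<in> cball 0 1. cmod (g x) \<ge> 1}"
  have "closed W"
    unfolding W_def by (intro continuous_closed_preimage_constant continuous_on_closed_Collect_le) (auto intro!: continuous_intros cont)
  have "W = cball 0 1 \<inter> W" by (auto simp: W_def)
  then have "compact W"
    using \<open>closed W\<close> by (metis compact_Int_closed compact_cball)
  have "W \<subseteq> interior K"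
  proof
    fix x assume x: "x \<in> W"
    show "x \<in> interior K"
    proof (cases "norm x = 1")
      case True
      then show ?thesis using x contact[of x] by (cases "x \<in> interior K") (auto simp: W_def g_def)
    next
      case False
      then have "x \<in> ball 0 1" using x by (auto simp: W_def)
      then show ?thesis using interior_mono[OF ball] by auto
    qed
  qed
  then obtain e where e: "e > 0" "(\<Union>x\<in>W. ball x e) \<subseteq> interior K"
    using compact_subset_open_imp_ball_epsilon_subset[OF \<open>compact W\<close> open_interior] by blast
  obtain L where L: "\<And>x. x \<in> cball 0 1 \<Longrightarrow> cmod (g x) \<le> L"
    using compact_imp_bounded[OF compact_continuous_image[OF cont compact_cball]] unfolding bounded_iff by blast
  have "L \<ge> 0" using L[of 0] norm_ge_zero[of "g 0"] by (simp del: norm_ge_zero)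
  \<comment> \<open>The first bound serves the determinant estimate, the second keeps the
    displacement, at most t (L + 1), below \<open>e\<close>.\<close>
  define t where "t = min (1 / (4 * n)) (e / (2 * (L + 1)))"
  have t: "0 < t" "t \<le> 1 / (4 * n)" "t * (L + 1) < e"
  proof -
    show "0 < t" "t \<le> 1 / (4 * n)" using \<open>n > 0\<close> \<open>e > 0\<close> \<open>L \<ge> 0\<close> by (auto simp: t_def)
    have "t * (L + 1) \<le> e / (2 * (L + 1)) * (L + 1)"
      using \<open>L \<ge> 0\<close> by (intro mult_right_mono) (auto simp: t_def)
    also have "\<dots> < e" using \<open>L \<ge> 0\<close> \<open>e > 0\<close> by (simp add: field_simps add_pos_nonneg)
    finally show "t * (L + 1) < e" .
  qed
  have nt: "n * t \<le> 1/4" using t(2) \<open>n > 0\<close> by (simp add: field_simps)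
  have "t \<le> n * t" using \<open>n > 0\<close> t(1) by simp
  then have t1: "t < 1" using nt by linarith
  define r :: "complex ^ 'n" where "r = (\<chi> j. of_real t * \<mu> * cnj (a $ j))"
  define M :: "complex ^ 'n ^ 'n" where
    "M = (\<chi> i. if i = k then axis k (of_real (1 - t)) + r else axis i (of_real (1 - t)))"
  have M_apply: "M *v x + axis k (- of_real t * \<mu> * c) = (1 - t) *\<^sub>R x + axis k (of_real t * g x)" for x
  proof -
    have diag: "(\<Sum>j\<in>UNIV. axis i (of_real (1 - t)) $ j * x $ j) = of_real (1 - t) * x $ i" for i
    proof -
      have "(\<Sum>j\<in>UNIV. axis i (of_real (1 - t)) $ j * x $ j) = (\<Sum>j\<in>UNIV. if j = i then of_real (1 - t) * x $ i else 0)"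
        by (intro sum.cong) (auto simp: axis_def)
      then show ?thesis by simp
    qed
    have r: "(\<Sum>j\<in>UNIV. r $ j * x $ j) = of_real t * \<mu> * cinner x a"
      unfolding r_def cinner_def sum_distrib_left by (intro sum.cong) auto
    have "(M *v x) $ i = of_real (1 - t) * x $ i + (if i = k then of_real t * \<mu> * cinner x a else 0)" for i
      using diag[of i] r
      by (cases "i = k") (simp_all add: M_def matrix_vector_mult_def distrib_right sum.distrib)
    then show ?thesis
      by (auto simp: vec_eq_iff g_def scaleR_conv_of_real[where 'a = complex] axis_def algebra_simps)
  qed
  have norm_axis: "norm (axis k z :: complex ^ 'n) = cmod z" for z
  proof -
    have "axis k z = z *s (axis k 1 :: complex ^ 'n)" by (auto simp: vec_eq_iff axis_def)
    moreover have "norm (axis k 1 :: complex ^ 'n) = 1"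
      using norm_eq_1 inner_axis_axis[of k 1 k 1] by (metis (no_types) inner_complex_def complex_eq_iff one_complex.sel mult_1 mult_zero_left add.right_neutral)
    ultimately show ?thesis by (simp add: norm_vector_mult)
  qed
  have "cmod (det M) \<le> 1"
  proof (rule max)
    fix x :: "complex ^ 'n" assume x: "x \<in> cball 0 1"
    show "M *v x + axis k (- of_real t * \<mu> * c) \<in> K"
    proof (cases "x \<in> W")
      case True
      have "norm (((1 - t) *\<^sub>R x + axis k (of_real t * g x)) - x) = norm (axis k (of_real t * g x) - t *\<^sub>R x)"
        by (simp add: algebra_simps)
      also have "\<dots> \<le> t * cmod (g x) + t * norm x"
        using norm_triangle_ineq4[of "axis k (of_real t * g x)" "t *\<^sub>R x"] t(1) by (simp add: norm_axis norm_mult)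
      also have "\<dots> \<le> t * L + t * 1"
        using L[OF x] x t(1) by (intro add_mono mult_left_mono) auto
      also have "\<dots> < e" using t(3) by (simp add: algebra_simps)
      finally have "(1 - t) *\<^sub>R x + axis k (of_real t * g x) \<in> ball x e"
        by (simp add: dist_norm norm_minus_commute)
      then show ?thesis
        unfolding M_apply using e(2) True interior_subset by blast
    next
      case False
      then have "cmod (g x) \<le> 1" using x by (auto simp: W_def)
      have "norm ((1 - t) *\<^sub>R x + axis k (of_real t * g x)) \<le> (1 - t) * norm x + t * cmod (g x)"
        using norm_triangle_ineq[of "(1 - t) *\<^sub>R x" "axis k (of_real t * g x)"] t(1) t1 by (simp add: norm_axis norm_mult)
      also have "\<dots> \<le> (1 - t) * 1 + t * 1"
        using \<open>cmod (g x) \<le> 1\<close> x t(1) t1 by (intro add_mono mult_left_mono) auto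
      finally show ?thesis
        unfolding M_apply using ball by auto
    qed
  qed
  moreover have "det M = of_real ((1 - t) ^ (n - 1) * (1 + 2 * n * t))"
  proof -
    have "r $ k = of_real ((2 * n + 1) * t)"
      using k by (simp add: r_def \<mu>_def)
    then show ?thesis
      unfolding M_def using t1 by (subst det_scalar_plus_row) (auto simp: n_def algebra_simps)
  qed
  ultimately have "(1 - t) ^ (n - 1) * (1 + 2 * n * t) \<le> 1"
    using t(1) t1 by (simp add: norm_mult norm_power del: of_real_mult of_real_power)
  \<comment> \<open>Bernoulli's inequality bounds the determinant below by (1 - nt)(1 + 2nt) = 1 +
    nt(1 - 2nt).\<close>
  moreover have "1 - n * t \<le> (1 - t) ^ (n - 1)"
  proof -
    have "1 - n * t \<le> 1 + real (n - 1) * (- t)"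
      using t(1) \<open>n > 0\<close> by (simp add: of_nat_diff algebra_simps)
    also have "\<dots> \<le> (1 + (- t)) ^ (n - 1)" using t1 by (intro Bernoulli_inequality) auto
    finally show ?thesis by simp
  qed
  then have "(1 - n * t) * (1 + 2 * n * t) \<le> (1 - t) ^ (n - 1) * (1 + 2 * n * t)"
    using t(1) by (intro mult_right_mono) auto
  moreover have "(1 - n * t) * (1 + 2 * n * t) > 1"
  proof -
    have "n * t > 0" using t(1) \<open>n > 0\<close> by simp
    then have "n * t * (1 - 2 * (n * t)) > 0" using nt by (intro mult_pos_pos[of "n * t"]) auto
    then show ?thesis by (simp add: algebra_simps)
  qed
  ultimately show False by linarith
qed

section \<open>Existence of a maximal inscribed ellipsoid\<close>

lemma norm_le_sum_components: "norm (x :: 'a::real_normed_vector ^ 'n) \<le> (\<Sum>i\<in>UNIV. norm (x $ i))"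
  unfolding norm_vec_def by (rule L2_set_le_sum) simp

text \<open>The affine maps carrying the ball into \<open>K\<close> form a compact set, on which
  \<open>cmod (det M)\<close> attains its maximum; real volume scales with the square of this
  number. A small ball inside \<open>K\<close> makes the maximum positive.\<close>

lemma exists_maximal_ellipsoid:
  fixes K :: "(complex ^ 'n) set"
  assumes "compact K" "interior K \<noteq> {}"
  obtains M :: "complex ^ 'n ^ 'n" and b where "det M \<noteq> 0" "\<And>x. x \<in> cball 0 1 \<Longrightarrow> M *v x + b \<in> K"
    "\<And>N c. (\<And>x. x \<in> cball 0 1 \<Longrightarrow> N *v x + c \<in> K) \<Longrightarrow> cmod (det N) \<le> cmod (det M)"
proof -
  define E :: "((complex ^ 'n ^ 'n) \<times> (complex ^ 'n)) set" where
    "E = (\<Inter>x\<in>cball 0 1. (\<lambda>p. fst p *v x + snd p) -` K)"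
  have E_mem: "(M, b) \<in> E \<longleftrightarrow> (\<forall>x\<in>cball 0 1. M *v x + b \<in> K)" for M b
    by (auto simp: E_def)
  have "closed E"
    unfolding E_def
  proof (intro closed_INT ballI continuous_closed_vimage compact_imp_closed[OF assms(1)])
    fix x :: "complex ^ 'n" and p :: "(complex ^ 'n ^ 'n) \<times> (complex ^ 'n)"
    have "continuous_on UNIV (\<lambda>p :: (complex ^ 'n ^ 'n) \<times> (complex ^ 'n). fst p *v x + snd p)"
      unfolding matrix_vector_mult_def by (intro continuous_intros)
    then show "isCont (\<lambda>p :: (complex ^ 'n ^ 'n) \<times> (complex ^ 'n). fst p *v x + snd p) p"
      by (simp only: continuous_on_eq_continuous_at[OF open_UNIV] UNIV_I ball_simps)
  qed
  moreover have "bounded E"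
  proof -
    obtain B where B: "\<And>x. x \<in> K \<Longrightarrow> norm x \<le> B"
      using compact_imp_bounded[OF assms(1)] unfolding bounded_iff by blast
    have "norm p \<le> real CARD('n) * (real CARD('n) * (2 * B)) + B" if "p \<in> E" for p
    proof -
      obtain M b where p: "p = (M, b)" by fastforce
      have M: "M *v x + b \<in> K" if "x \<in> cball 0 1" for x using \<open>p \<in> E\<close> that by (simp add: p E_mem)
      \<comment> \<open>The vector \<open>b\<close> is the image of the centre and each column of
        \<open>M\<close> is a difference of two points of \<open>K\<close>, which bounds all
        entries.\<close>
      have b: "norm b \<le> B" using B[OF M[of 0]] by simp
      have entry: "cmod (M $ i $ j) \<le> 2 * B" for i j
      proof -
        have ax: "axis j 1 \<in> cball (0 :: complex ^ 'n) 1"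
          using norm_le_sum_components[of "axis j 1 :: complex ^ 'n"] by (simp add: axis_def if_distrib cong: if_cong)
        have "M $ i $ j = (M *v axis j 1) $ i"
          by (simp add: matrix_vector_mult_def axis_def if_distrib cong: if_cong)
        then have "cmod (M $ i $ j) \<le> norm (M *v axis j 1)"
          by (metis Finite_Cartesian_Product.norm_nth_le)
        also have "\<dots> = norm ((M *v axis j 1 + b) - b)" by simp
        also have "\<dots> \<le> norm (M *v axis j 1 + b) + norm b" by (rule norm_triangle_ineq4)
        finally show ?thesis using B[OF M[OF ax]] b by simp
      qed
      have "norm (M $ i) \<le> real CARD('n) * (2 * B)" for i
        using norm_le_sum_components[of "M $ i"] sum_bounded_above[of UNIV "\<lambda>j. cmod (M $ i $ j)" "2 * B"] entry
        by fastforce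
      then have "norm M \<le> real CARD('n) * (real CARD('n) * (2 * B))"
        using norm_le_sum_components[of M] sum_bounded_above[of UNIV "\<lambda>j. norm (M $ j)" "real CARD('n) * (2 * B)"]
        by fastforce
      then show ?thesis
        using b norm_Pair_le[of M b] by (simp add: p)
    qed
    then show ?thesis unfolding bounded_iff by blast
  qed
  ultimately have "compact E" by (simp add: compact_eq_bounded_closed)
  obtain x0 where "x0 \<in> interior K" using assms(2) by blast
  then obtain e where e: "e > 0" "cball x0 e \<subseteq> K" by (meson mem_interior_cball)
  define M0 :: "complex ^ 'n ^ 'n" where "M0 = (\<chi> i. axis i (of_real e))"
  have M0_mult: "M0 *v x = e *\<^sub>R x" for x
  proof -
    have "(\<Sum>j\<in>UNIV. axis i (of_real e) $ j * x $ j) = of_real e * x $ i" for i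
    proof -
      have "(\<Sum>j\<in>UNIV. axis i (of_real e) $ j * x $ j) = (\<Sum>j\<in>UNIV. if j = i then of_real e * x $ i else 0)"
        by (intro sum.cong) (auto simp: axis_def)
      then show ?thesis by simp
    qed
    then show ?thesis
      by (simp add: M0_def matrix_vector_mult_def vec_eq_iff scaleR_conv_of_real[where 'a = complex])
  qed
  have "(M0, x0) \<in> E"
    unfolding E_mem M0_mult using e by (auto simp: dist_norm subset_iff mult_left_le)
  have "det M0 = of_real e ^ CARD('n)"
    by (subst det_diagonal) (auto simp: M0_def axis_def)
  then have "cmod (det M0) > 0" using e by (simp add: norm_power)
  have "continuous_on E (\<lambda>p. cmod (det (fst p)))"
    unfolding det_def by (intro continuous_intros)
  then obtain p where p: "p \<in> E" "\<And>q. q \<in> E \<Longrightarrow> cmod (det (fst q)) \<le> cmod (det (fst p))"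
    using continuous_attains_sup[OF \<open>compact E\<close>] \<open>(M0, x0) \<in> E\<close> by blast
  show thesis
  proof (rule that[of "fst p" "snd p"])
    show "det (fst p) \<noteq> 0"
      using p(2)[OF \<open>(M0, x0) \<in> E\<close>] \<open>cmod (det M0) > 0\<close> by auto
    show "fst p *v x + snd p \<in> K" if "x \<in> cball 0 1" for x
      using p(1) that E_mem[of "fst p" "snd p"] by simp
    show "cmod (det N) \<le> cmod (det (fst p))" if "\<And>x. x \<in> cball 0 1 \<Longrightarrow> N *v x + c \<in> K" for N c
      using p(2)[of "(N, c)"] that by (simp add: E_mem)
  qed
qed

section \<open>Chain-closed subsets of the sphere\<close>

lemma complex_triangle_with_sides:
  assumes "r \<ge> 0" "t \<ge> 0" "r + t \<ge> 1" "r \<le> t + 1" "t \<le> r + 1"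
  obtains l where "cmod l = r" "cmod (1 - l) = t"
proof -
  \<comment> \<open>The real part of the apex of the triangle over the segment from 0 to 1, by the
    law of cosines.\<close>
  define x where "x = (r\<^sup>2 - t\<^sup>2 + 1) / 2"
  have "(r - 1)\<^sup>2 \<le> t\<^sup>2" "t\<^sup>2 \<le> (r + 1)\<^sup>2"
    using assms by (auto intro!: power_mono simp: abs_le_square_iff[symmetric] abs_le_iff)
  then have "\<bar>x\<bar> \<le> r" by (auto simp: x_def power2_eq_square algebra_simps abs_le_iff)
  then have y: "r\<^sup>2 - x\<^sup>2 \<ge> 0" using assms(1) by (simp add: abs_le_square_iff[symmetric])
  define l where "l = Complex x (sqrt (r\<^sup>2 - x\<^sup>2))"
  have "(cmod l)\<^sup>2 = r\<^sup>2" using y by (simp add: l_def cmod_power2)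
  moreover have "(cmod (1 - l))\<^sup>2 = t\<^sup>2"
    using y by (simp add: l_def cmod_power2 power2_diff) (simp add: x_def field_simps)
  ultimately show thesis
    using that[of l] assms(1,2) by (metis norm_ge_zero power2_eq_imp_eq)
qed

text \<open>In the coordinates \<open>\<alpha>, \<beta>, n\<close> the Hermitian form of signature \<open>(n, 1)\<close> is
  \<open>2 Re (\<alpha> cnj \<beta>) + \<parallel>n\<parallel>\<^sup>2\<close>; \<open>Q\<close> is the cone over a chain-closed subset of the sphere.\<close>

locale null_cone =
  fixes Q :: "complex \<Rightarrow> complex \<Rightarrow> complex ^ 'n \<Rightarrow> bool"
  assumes scale: "Q \<alpha> \<beta> n \<Longrightarrow> Q (c * \<alpha>) (c * \<beta>) (c *s n)"
    and add: "\<lbrakk>Q \<alpha> \<beta> n; Q \<alpha>' \<beta>' n'; 2 * Re ((\<alpha> + \<alpha>') * cnj (\<beta> + \<beta>')) + (norm (n + n'))\<^sup>2 = 0\<rbrakk>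
      \<Longrightarrow> Q (\<alpha> + \<alpha>') (\<beta> + \<beta>') (n + n')"
    and null: "Q \<alpha> \<beta> n \<Longrightarrow> 2 * Re (\<alpha> * cnj \<beta>) + (norm n)\<^sup>2 = 0"
    and base: "Q 1 0 0" "Q 0 1 0"
begin

lemma Q_zero:
  assumes "Re (\<alpha> * cnj \<beta>) = 0"
  shows "Q \<alpha> \<beta> 0"
  using add[OF scale[OF base(1), of \<alpha>] scale[OF base(2), of \<beta>]] assms by simp

text \<open>Subtracting a suitable unit multiple \<open>s\<close> of the given vector leaves a null
  vector in the span of the base vectors, so the cone contains \<alpha>, \<beta> with
  \<open>s *s n\<close>. Two different such \<open>s\<close> exist, and an affine combination of the
  two resulting vectors has last component \<open>n\<close>.\<close>

lemma Q_generic: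
  assumes Q0: "Q \<alpha>\<^sub>0 \<beta>\<^sub>0 n" and n: "2 * Re (\<alpha> * cnj \<beta>) + (norm n)\<^sup>2 = 0" and gen: "\<alpha> * \<beta>\<^sub>0 \<noteq> \<beta> * \<alpha>\<^sub>0"
  shows "Q \<alpha> \<beta> n"
proof -
  define N where "N = (norm n)\<^sup>2"
  \<comment> \<open>The Hermitian pairing of (\<alpha>, \<beta>) with
    \<open>(\<alpha>\<^sub>0, \<beta>\<^sub>0)\<close>.\<close>
  define \<eta> where "\<eta> = \<alpha> * cnj \<beta>\<^sub>0 + \<beta> * cnj \<alpha>\<^sub>0"
  have N: "2 * Re (\<alpha> * cnj \<beta>) = - N" "2 * Re (\<alpha>\<^sub>0 * cnj \<beta>\<^sub>0) = - N"
    using n null[OF Q0] by (simp_all add: N_def)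
  \<comment> \<open>The reverse Cauchy--Schwarz inequality with its defect; strictness gives two solutions \<open>s\<close> below.\<close>
  have "(cmod \<eta>)\<^sup>2 = (2 * Re (\<alpha> * cnj \<beta>)) * (2 * Re (\<alpha>\<^sub>0 * cnj \<beta>\<^sub>0)) + (cmod (\<alpha> * \<beta>\<^sub>0 - \<beta> * \<alpha>\<^sub>0))\<^sup>2"
    unfolding \<eta>_def cmod_power2 by (simp add: power2_eq_square algebra_simps)
  then have "(cmod \<eta>)\<^sup>2 = N\<^sup>2 + (cmod (\<alpha> * \<beta>\<^sub>0 - \<beta> * \<alpha>\<^sub>0))\<^sup>2"
    unfolding N by (simp add: power2_eq_square)
  moreover define k where "k = cmod (\<alpha> * \<beta>\<^sub>0 - \<beta> * \<alpha>\<^sub>0)"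
  ultimately have \<eta>: "(cmod \<eta>)\<^sup>2 = N\<^sup>2 + k\<^sup>2" and k: "k > 0"
    using gen by auto
  then have "\<eta> \<noteq> 0"
    by (metis add_nonneg_pos norm_zero zero_le_power2 zero_less_power2 less_irrefl power_zero_numeral)
  have step: "Q \<alpha> \<beta> (s *s n)" if s: "cmod s = 1" "Re (cnj s * \<eta>) = - N" for s
  proof -
    have ss: "s * cnj s = 1" using s(1) by (simp add: complex_norm_square[symmetric])
    have "(\<alpha> - s * \<alpha>\<^sub>0) * cnj (\<beta> - s * \<beta>\<^sub>0)
        = \<alpha> * cnj \<beta> + (s * cnj s) * (\<alpha>\<^sub>0 * cnj \<beta>\<^sub>0) - (cnj s * (\<alpha> * cnj \<beta>\<^sub>0) + cnj (cnj s * (\<beta> * cnj \<alpha>\<^sub>0)))"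
      by (simp add: algebra_simps)
    then have "Re ((\<alpha> - s * \<alpha>\<^sub>0) * cnj (\<beta> - s * \<beta>\<^sub>0))
        = Re (\<alpha> * cnj \<beta>) + Re (\<alpha>\<^sub>0 * cnj \<beta>\<^sub>0) - (Re (cnj s * (\<alpha> * cnj \<beta>\<^sub>0)) + Re (cnj (cnj s * (\<beta> * cnj \<alpha>\<^sub>0))))"
      unfolding ss by (simp only: minus_complex.sel plus_complex.sel mult_1_left)
    also have "\<dots> = Re (\<alpha> * cnj \<beta>) + Re (\<alpha>\<^sub>0 * cnj \<beta>\<^sub>0) - Re (cnj s * \<eta>)"
      by (simp only: \<eta>_def distrib_left plus_complex.sel cnj.sel)
    also have "\<dots> = 0"
      using N s(2) by simp
    finally have "Q (\<alpha> - s * \<alpha>\<^sub>0) (\<beta> - s * \<beta>\<^sub>0) 0"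
      by (rule Q_zero)
    then show ?thesis
      using add[OF _ scale[OF Q0, of s], of "\<alpha> - s * \<alpha>\<^sub>0" "\<beta> - s * \<beta>\<^sub>0" 0] n s(1)
      by (simp add: norm_vector_mult)
  qed
  \<comment> \<open>Chosen so that \<open>cnj (s \<epsilon>) * \<eta>\<close> has real part -N and
    imaginary part -\<epsilon>k; its modulus is that of \<eta>, hence \<open>s \<epsilon>\<close> is
    a unit.\<close>
  define s where "s = (\<lambda>\<epsilon>. \<eta> * Complex (- N) (\<epsilon> * k) / of_real ((cmod \<eta>)\<^sup>2))"
  have s: "Q \<alpha> \<beta> (s \<epsilon> *s n)" if "\<epsilon>\<^sup>2 = 1" for \<epsilon>
  proof (rule step)
    have "cmod (Complex (- N) (\<epsilon> * k)) = cmod \<eta>"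
      using \<eta> that by (simp add: complex_norm power_mult_distrib) (metis norm_ge_zero real_sqrt_unique)
    then show "cmod (s \<epsilon>) = 1"
      using \<open>\<eta> \<noteq> 0\<close> by (simp add: s_def norm_mult norm_divide norm_power power2_eq_square)
    have "cnj (s \<epsilon>) * \<eta> = cnj (Complex (- N) (\<epsilon> * k)) * (\<eta> * cnj \<eta>) / of_real ((cmod \<eta>)\<^sup>2)"
      by (simp add: s_def)
    also have "\<dots> = cnj (Complex (- N) (\<epsilon> * k))"
      using \<open>\<eta> \<noteq> 0\<close> by (simp add: complex_norm_square[symmetric])
    finally show "Re (cnj (s \<epsilon>) * \<eta>) = - N" by simp
  qed
  have ne: "s 1 - s (-1) \<noteq> 0"
  proof
    assume "s 1 - s (-1) = 0"
    then have "Complex (- N) (1 * k) = Complex (- N) (- 1 * k)"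
      using \<open>\<eta> \<noteq> 0\<close> by (simp add: s_def)
    then show False using k by simp
  qed
  define l where "l = (1 - s (-1)) / (s 1 - s (-1))"
  have l: "l * s 1 + (1 - l) * s (-1) = 1"
  proof -
    have "l * (s 1 - s (-1)) = 1 - s (-1)" using ne by (simp add: l_def)
    then show ?thesis by (simp add: algebra_simps)
  qed
  have "l *s (s 1 *s n) + (1 - l) *s (s (-1) *s n) = (l * s 1 + (1 - l) * s (-1)) *s n"
    by (simp add: vec_eq_iff algebra_simps)
  then have "l *s (s 1 *s n) + (1 - l) *s (s (-1) *s n) = n"
    by (simp add: l)
  moreover have "l * z + (1 - l) * z = z" for z :: complex
    by (simp add: algebra_simps)
  ultimately show ?thesis
    using add[OF scale[OF s[of 1], of l] scale[OF s[of "-1"], of "1 - l"]] n by simp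
qed

lemma Q_same_normal:
  assumes Q0: "Q \<alpha>\<^sub>0 \<beta>\<^sub>0 n" and n: "2 * Re (\<alpha> * cnj \<beta>) + (norm n)\<^sup>2 = 0"
  shows "Q \<alpha> \<beta> n"
proof (cases "n = 0 \<or> \<alpha> * \<beta>\<^sub>0 \<noteq> \<beta> * \<alpha>\<^sub>0")
  case True
  then show ?thesis
    using Q_zero[of \<alpha> \<beta>] Q_generic[OF Q0 n] n by auto
next
  case False
  then have n0: "n \<noteq> 0" and pr: "\<alpha> * \<beta>\<^sub>0 = \<beta> * \<alpha>\<^sub>0" by auto
  define N where "N = (norm n)\<^sup>2"
  have N: "2 * Re (\<alpha> * cnj \<beta>) = - N" "2 * Re (\<alpha>\<^sub>0 * cnj \<beta>\<^sub>0) = - N" "N > 0"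
    using n null[OF Q0] n0 by (simp_all add: N_def)
  \<comment> \<open>Split the vector into two halves, pushed off \<open>(\<alpha>\<^sub>0, \<beta>\<^sub>0)\<close> along its orthogonal \<open>(cnj \<alpha>\<^sub>0, - cnj \<beta>\<^sub>0)\<close>,
    so that each half is generic.\<close>
  have half: "Q (c * \<alpha> + \<epsilon> * cnj \<alpha>\<^sub>0) (c * \<beta> - \<epsilon> * cnj \<beta>\<^sub>0) ((1/2) *s n)"
    if c: "(cmod c)\<^sup>2 = 5/4" and \<epsilon>: "\<epsilon> = 1 \<or> \<epsilon> = -1" for c \<epsilon>
  proof (rule Q_generic)
    show "Q ((1/2) * \<alpha>\<^sub>0) ((1/2) * \<beta>\<^sub>0) ((1/2) *s n)" by (rule scale[OF Q0])
    have cc: "c * cnj c = of_real (5/4)" using c by (metis complex_norm_square)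
    have \<epsilon>': "cnj \<epsilon> = \<epsilon>" "\<epsilon> * \<epsilon> = 1" using \<epsilon> by auto
    have "(c * \<alpha> + \<epsilon> * cnj \<alpha>\<^sub>0) * cnj (c * \<beta> - \<epsilon> * cnj \<beta>\<^sub>0)
       = (c * cnj c) * (\<alpha> * cnj \<beta>) - (\<epsilon> * \<epsilon>) * cnj (\<alpha>\<^sub>0 * cnj \<beta>\<^sub>0) + (cnj (c * \<epsilon> * (\<beta> * \<alpha>\<^sub>0)) - c * \<epsilon> * (\<alpha> * \<beta>\<^sub>0))"
      by (simp add: \<epsilon>' algebra_simps)
    also have "\<dots> = of_real (5/4) * (\<alpha> * cnj \<beta>) - cnj (\<alpha>\<^sub>0 * cnj \<beta>\<^sub>0) + (cnj (c * \<epsilon> * (\<beta> * \<alpha>\<^sub>0)) - c * \<epsilon> * (\<beta> * \<alpha>\<^sub>0))"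
      by (simp only: cc \<epsilon>' pr mult_1_left)
    moreover have "Re (of_real (5/4) * z) = 5/4 * Re z" for z
      by simp
    ultimately have "Re ((c * \<alpha> + \<epsilon> * cnj \<alpha>\<^sub>0) * cnj (c * \<beta> - \<epsilon> * cnj \<beta>\<^sub>0)) = 5/4 * Re (\<alpha> * cnj \<beta>) - Re (\<alpha>\<^sub>0 * cnj \<beta>\<^sub>0)"
      by (simp only: plus_complex.sel minus_complex.sel cnj.sel)
    moreover have "(norm ((1/2) *s n))\<^sup>2 = N / 4"
      by (simp add: N_def norm_vector_mult power_mult_distrib norm_divide power_divide)
    ultimately show "2 * Re ((c * \<alpha> + \<epsilon> * cnj \<alpha>\<^sub>0) * cnj (c * \<beta> - \<epsilon> * cnj \<beta>\<^sub>0)) + (norm ((1/2) *s n))\<^sup>2 = 0"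
      using N by linarith
    have "(c * \<alpha> + \<epsilon> * cnj \<alpha>\<^sub>0) * ((1/2) * \<beta>\<^sub>0) - (c * \<beta> - \<epsilon> * cnj \<beta>\<^sub>0) * ((1/2) * \<alpha>\<^sub>0)
       = (1/2) * c * (\<alpha> * \<beta>\<^sub>0 - \<beta> * \<alpha>\<^sub>0) + (\<epsilon> / 2) * (\<alpha>\<^sub>0 * cnj \<beta>\<^sub>0 + cnj (\<alpha>\<^sub>0 * cnj \<beta>\<^sub>0))"
      by (simp add: algebra_simps)
    also have "\<dots> = \<epsilon> / 2 * of_real (2 * Re (\<alpha>\<^sub>0 * cnj \<beta>\<^sub>0))"
      unfolding complex_add_cnj pr by simp
    also have "\<dots> \<noteq> 0"
      unfolding N using N(3) \<epsilon> by auto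
    finally show "(c * \<alpha> + \<epsilon> * cnj \<alpha>\<^sub>0) * ((1/2) * \<beta>\<^sub>0) \<noteq> (c * \<beta> - \<epsilon> * cnj \<beta>\<^sub>0) * ((1/2) * \<alpha>\<^sub>0)"
      by auto
  qed
  have "(1/2) *s n + (1/2) *s n = n"
    by (simp add: vec_eq_iff)
  \<comment> \<open>The weights 1/2 + i and 1/2 - i sum to 1. Their squared modulus 5/4 is what
    makes each half null: -(5/4) N + N + N/4 = 0.\<close>
  moreover have "Complex (1/2) 1 * z + Complex (1/2) (-1) * z = z" for z
    by (simp add: complex_eq_iff)
  then have "(Complex (1/2) 1 * \<alpha> + 1 * cnj \<alpha>\<^sub>0) + (Complex (1/2) (-1) * \<alpha> + (-1) * cnj \<alpha>\<^sub>0) = \<alpha>"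
    "(Complex (1/2) 1 * \<beta> - 1 * cnj \<beta>\<^sub>0) + (Complex (1/2) (-1) * \<beta> - (-1) * cnj \<beta>\<^sub>0) = \<beta>"
    by (simp_all add: algebra_simps)
  moreover have "(cmod (Complex (1/2) 1))\<^sup>2 = 5/4" "(cmod (Complex (1/2) (-1)))\<^sup>2 = 5/4"
    unfolding cmod_power2 by (simp_all add: power2_eq_square)
  ultimately show ?thesis
    using add[OF half[of "Complex (1/2) 1" 1] half[of "Complex (1/2) (-1)" "-1"]] n by metis
qed

text \<open>By \<open>Q_same_normal\<close> this is the projection of the cone to its last
  component. Asking for the whole fibre leaves \<alpha> and \<beta> free to be chosen when showing
  that it is a complex subspace.\<close>

definition full_normals :: "(complex ^ 'n) set" where
  "full_normals = {n. \<forall>\<alpha> \<beta>. 2 * Re (\<alpha> * cnj \<beta>) + (norm n)\<^sup>2 = 0 \<longrightarrow> Q \<alpha> \<beta> n}"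

lemma Q_full_normals: "Q \<alpha> \<beta> n \<Longrightarrow> n \<in> full_normals"
  using Q_same_normal by (auto simp: full_normals_def)

lemma full_normals_scale:
  assumes "n \<in> full_normals"
  shows "c *s n \<in> full_normals"
proof (cases "c = 0")
  case True
  then show ?thesis using Q_full_normals[OF base(1)] by simp
next
  case False
  show ?thesis
    unfolding full_normals_def
  proof (intro CollectI allI impI)
    fix \<alpha> \<beta> assume *: "2 * Re (\<alpha> * cnj \<beta>) + (norm (c *s n))\<^sup>2 = 0"
    have "\<alpha> * cnj \<beta> = of_real ((cmod c)\<^sup>2) * ((\<alpha> / c) * cnj (\<beta> / c))"
      using False unfolding complex_norm_square by simp
    then have "Re (\<alpha> * cnj \<beta>) = (cmod c)\<^sup>2 * Re ((\<alpha> / c) * cnj (\<beta> / c))"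
      by (metis Re_complex_of_real Im_complex_of_real diff_zero mult_zero_left times_complex.sel(1))
    with * have "(cmod c)\<^sup>2 * (2 * Re ((\<alpha> / c) * cnj (\<beta> / c)) + (norm n)\<^sup>2) = 0"
      by (simp only: norm_vector_mult power_mult_distrib distrib_left mult.left_commute)
    then have "2 * Re ((\<alpha> / c) * cnj (\<beta> / c)) + (norm n)\<^sup>2 = 0"
      using False by simp
    then have "Q (\<alpha> / c) (\<beta> / c) n"
      using assms unfolding full_normals_def by blast
    then show "Q \<alpha> \<beta> (c *s n)"
      using scale[of "\<alpha> / c" "\<beta> / c" n c] False by simp
  qed
qed

text \<open>Split (\<alpha>, \<beta>) into the multiples by \<open>l\<close> and 1 - l, paired with
  \<open>n\<close> and \<open>n'\<close>. Both parts are null when |l| and |1 - l| are the ratios of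
  the norms of \<open>n\<close> and \<open>n'\<close> to that of \<open>n + n'\<close>; such an
  \<open>l\<close> exists by the triangle inequality.\<close>

lemma full_normals_add:
  assumes "n \<in> full_normals" "n' \<in> full_normals"
  shows "n + n' \<in> full_normals"
  unfolding full_normals_def
proof (intro CollectI allI impI)
  fix \<alpha> \<beta> assume *: "2 * Re (\<alpha> * cnj \<beta>) + (norm (n + n'))\<^sup>2 = 0"
  define R where "R = norm (n + n')"
  show "Q \<alpha> \<beta> (n + n')"
  proof (cases "R = 0")
    case True
    then show ?thesis using * Q_zero[of \<alpha> \<beta>] by (simp add: R_def)
  next
    case False
    then have R: "R > 0" by (simp add: R_def)
    have tri: "R \<le> norm n + norm n'" "norm n \<le> norm n' + R" "norm n' \<le> norm n + R"
      using norm_triangle_ineq[of n n'] norm_triangle_ineq4[of "n + n'" n'] norm_triangle_ineq4[of "n + n'" n]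
      by (simp_all add: R_def add.commute)
    obtain l where l: "cmod l = norm n / R" "cmod (1 - l) = norm n' / R"
      by (rule complex_triangle_with_sides[of "norm n / R" "norm n' / R"])
        (use tri R in \<open>simp_all add: field_simps\<close>)
    have part: "Q (c * \<alpha>) (c * \<beta>) k" if "cmod c = norm k / R" "k \<in> full_normals" for c k
    proof -
      have "(c * \<alpha>) * cnj (c * \<beta>) = of_real ((cmod c)\<^sup>2) * (\<alpha> * cnj \<beta>)"
        unfolding complex_norm_square by (simp add: algebra_simps)
      then have "Re ((c * \<alpha>) * cnj (c * \<beta>)) = (cmod c)\<^sup>2 * Re (\<alpha> * cnj \<beta>)"
        by (metis Re_complex_of_real Im_complex_of_real diff_zero mult_zero_left times_complex.sel(1))
      also have "\<dots> = (norm k)\<^sup>2 / R\<^sup>2 * (- (R\<^sup>2 / 2))"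
      proof -
        have "Re (\<alpha> * cnj \<beta>) = - (R\<^sup>2 / 2)" using * unfolding R_def by linarith
        then show ?thesis by (simp only: that(1) power_divide)
      qed
      finally have "2 * Re ((c * \<alpha>) * cnj (c * \<beta>)) + (norm k)\<^sup>2 = 0"
        using R by simp
      then show ?thesis
        using that(2) unfolding full_normals_def by blast
    qed
    have "l * z + (1 - l) * z = z" for z :: complex
      by (simp add: algebra_simps)
    then show ?thesis
      using add[OF part[OF l(1) assms(1)] part[OF l(2) assms(2)]] * by simp
  qed
qed

end

section \<open>From the null cone back to the sphere\<close>

text \<open>Lift \<open>u\<close> to (u, 1) and use the form |z|^2 - |t|^2, whose null cone lies
  over the sphere. Lifts of two points of \<open>C\<close> serve as base vectors of a
  \<open>null_cone\<close>. The vectors whose last component is a full normal form a complex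
  subspace containing all lifts of \<open>C\<close>; as \<open>C\<close> spans, it is
  everything.\<close>

lemma chain_closed_spanning_eq_sphere:
  fixes C :: "(complex ^ 'n) set"
  assumes unit: "\<And>u. u \<in> C \<Longrightarrow> norm u = 1"
    and chain: "\<And>u v s. \<lbrakk>u \<in> C; v \<in> C; norm (u + s *s (v - u)) = 1\<rbrakk> \<Longrightarrow> u + s *s (v - u) \<in> C"
    and span: "\<And>a c. a \<noteq> 0 \<Longrightarrow> \<exists>u\<in>C. cinner u a \<noteq> c"
    and w: "norm w = 1"
  shows "w \<in> C"
proof -
  define e :: "complex ^ 'n" where "e = axis undefined 1"
  have ax: "e \<noteq> 0" by (simp add: e_def axis_eq_0_iff)
  obtain x where x: "x \<in> C" using span[OF ax] by blast
  obtain y where y: "y \<in> C" "y \<noteq> x" using span[OF ax, of "cinner x e"] by blast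
  \<comment> \<open>The pairing of the lifts (x, 1) and (y, 1).\<close>
  define g where "g = cinner x y - 1"
  have xy: "cinner x y = 1 + g" by (simp add: g_def)
  have yx: "cinner y x = 1 + cnj g" by (subst cinner_commute) (simp add: xy)
  have xx: "cinner x x = 1" "cinner y y = 1" using unit x y by (simp_all add: cinner_self)
  have D: "(norm (y - x))\<^sup>2 = - 2 * Re g"
  proof -
    have "complex_of_real ((norm (y - x))\<^sup>2) = cinner (y - x) (y - x)" by (simp add: cinner_self)
    also have "\<dots> = - (g + cnj g)" by (simp add: cinner_diff_left cinner_diff_right xx xy yx)
    finally show ?thesis
      unfolding complex_add_cnj by (metis Re_complex_of_real mult_minus_left of_real_minus)
  qed
  have g: "g \<noteq> 0" using D y(2) by auto
  \<comment> \<open>\<open>B\<close> pairs (z, t) with (x, 1), and \<open>A\<close> pairs it with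
    (y, 1), divided by \<open>g\<close>. Removing the components along both lifts leaves (z1, t1)
    orthogonal to them, and \<open>Z\<close> is z1 - t1 x, whose squared norm is |z1|^2 -
    |t1|^2.\<close>
  define A where "A = (\<lambda>(z :: complex ^ 'n) t. (cinner z y - t) / g)"
  define B where "B = (\<lambda>(z :: complex ^ 'n) t. cinner z x - t)"
  define Z where "Z = (\<lambda>z t. z - t *s x - (B z t / cnj g) *s (y - x))"
  have lin_add: "A (z + z') (t + t') = A z t + A z' t'" "B (z + z') (t + t') = B z t + B z' t'"
    "Z (z + z') (t + t') = Z z t + Z z' t'" for z z' t t'
    by (simp_all add: A_def B_def Z_def cinner_add_left vec_eq_iff diff_divide_distrib add_divide_distrib algebra_simps)
  have lin_scale: "A (c *s z) (c * t) = c * A z t" "B (c *s z) (c * t) = c * B z t"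
    "Z (c *s z) (c * t) = c *s Z z t" for c z t
    by (simp_all add: A_def B_def Z_def cinner_scale_left vec_eq_iff diff_divide_distrib algebra_simps)
  have form: "(norm z)\<^sup>2 - (cmod t)\<^sup>2 = 2 * Re (A z t * cnj (B z t)) + (norm (Z z t))\<^sup>2" for z t
  proof -
    define \<alpha> \<beta> where "\<alpha> = A z t" and "\<beta> = B z t"
    have zx: "cinner z x = t + \<beta>" and zy: "cinner z y = t + \<alpha> * g"
      using g by (simp_all add: \<alpha>_def \<beta>_def A_def B_def)
    define P where "P = z + (- t) *s x"
    have xz: "cinner x z = cnj (t + \<beta>)" by (subst cinner_commute) (simp add: zx)
    have P: "(norm P)\<^sup>2 = (norm z)\<^sup>2 - (cmod t)\<^sup>2 - 2 * Re (t * cnj \<beta>)"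
    proof -
      have "- t * cinner x z = - (of_real ((cmod t)\<^sup>2) + t * cnj \<beta>)"
        unfolding xz complex_norm_square by (simp add: algebra_simps)
      then have "Re (- t * cinner x z) = - ((cmod t)\<^sup>2 + Re (t * cnj \<beta>))"
        by (simp only: uminus_complex.sel plus_complex.sel Re_complex_of_real)
      then show ?thesis
        unfolding P_def norm_line_sq using unit[OF x] by (simp only: norm_minus_cancel) simp
    qed
    have "cinner P (y - x) = \<alpha> * g - \<beta> - t * g"
      unfolding P_def cinner_add_left cinner_scale_left cinner_diff_right zx zy xy xx by (simp add: algebra_simps)
    then have DP: "cinner (y - x) P = cnj (\<alpha> * g - \<beta> - t * g)" by (subst cinner_commute) simp
    have "- (\<beta> / cnj g) * cinner (y - x) P = - cnj (\<alpha> * cnj \<beta>) + of_real ((cmod \<beta>)\<^sup>2) / cnj g + cnj (t * cnj \<beta>)"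
      unfolding DP complex_norm_square using g by (simp add: field_simps)
    moreover have "Re (of_real ((cmod \<beta>)\<^sup>2) / cnj g) = (cmod \<beta>)\<^sup>2 * Re g / (cmod g)\<^sup>2"
      unfolding Re_divide cmod_power2 by simp
    ultimately have R: "Re (- (\<beta> / cnj g) * cinner (y - x) P)
        = - Re (\<alpha> * cnj \<beta>) + (cmod \<beta>)\<^sup>2 * Re g / (cmod g)\<^sup>2 + Re (t * cnj \<beta>)"
      by (simp only: uminus_complex.sel plus_complex.sel cnj.sel)
    have Z: "Z z t = P + (- (\<beta> / cnj g)) *s (y - x)"
      by (simp add: Z_def P_def \<beta>_def vec_eq_iff)
    have "(norm (Z z t))\<^sup>2 = (norm P)\<^sup>2 + 2 * (- Re (\<alpha> * cnj \<beta>) + (cmod \<beta>)\<^sup>2 * Re g / (cmod g)\<^sup>2 + Re (t * cnj \<beta>))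
        + (cmod \<beta>)\<^sup>2 / (cmod g)\<^sup>2 * (- 2 * Re g)"
      unfolding Z norm_line_sq R D by (simp add: norm_divide power_divide)
    also have "\<dots> = (norm z)\<^sup>2 - (cmod t)\<^sup>2 - 2 * Re (\<alpha> * cnj \<beta>)"
      unfolding P by (simp del: times_complex.sel add: distrib_left)
    finally show ?thesis unfolding \<alpha>_def \<beta>_def by linarith
  qed
  have inj: "z = 0 \<and> t = 0" if "A z t = 0" "B z t = 0" "Z z t = 0" for z t
  proof -
    have z: "z = t *s x" using that(2,3) by (simp add: Z_def)
    then have "t * g = 0" using that(1) g by (simp add: A_def cinner_scale_left xy algebra_simps)
    then show ?thesis using g z by simp
  qed
  \<comment> \<open>The cone over \<open>C\<close>; at t = 0 only the zero vector is null.\<close>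
  define N where "N = (\<lambda>z t. (z = 0 \<and> t = 0) \<or> (t \<noteq> 0 \<and> (1 / t) *s z \<in> C))"
  define Q where "Q = (\<lambda>\<alpha> \<beta> n. \<exists>z t. N z t \<and> A z t = \<alpha> \<and> B z t = \<beta> \<and> Z z t = n)"
  have N_norm: "norm z = cmod t" if "N z t" for z t
  proof (cases "t = 0")
    case False
    then have "norm ((1 / t) *s z) = 1" using that unit by (auto simp: N_def)
    then show ?thesis using False by (simp add: norm_vector_mult norm_divide field_simps)
  qed (use that in \<open>auto simp: N_def\<close>)
  have N_scale: "N (c *s z) (c * t)" if "N z t" for c z t
    using that by (cases "c = 0") (auto simp: N_def)
  have N_add: "N (z + z') (t + t')" if N: "N z t" "N z' t'" and n: "norm (z + z') = cmod (t + t')" for z z' t t'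
  proof -
    consider "t = 0" | "t' = 0" | "t + t' = 0" | "t \<noteq> 0" "t' \<noteq> 0" "t + t' \<noteq> 0" by blast
    then show ?thesis
    proof cases
      case 4
      define u v where "u = (1 / t) *s z" and "v = (1 / t') *s z'"
      have uv: "u \<in> C" "v \<in> C" using N 4 by (auto simp: N_def u_def v_def)
      \<comment> \<open>The sum of two lifts represents the barycentre of \<open>u\<close> and
        \<open>v\<close> with weights \<open>t\<close> and \<open>t'\<close>, a point of their
        line.\<close>
      have "u + (t' / (t + t')) *s (v - u) = (1 / (t + t')) *s (z + z')"
      proof -
        have "a / t + (t' / (t + t')) * (b / t' - a / t) = (a + b) / (t + t')" for a b
        proof -
          have "a / t + (t' / (t + t')) * (b / t' - a / t) = (a / t) * (1 - t' / (t + t')) + b / (t + t')"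
            using 4(2) by (simp add: algebra_simps)
          also have "1 - t' / (t + t') = t / (t + t')" using 4(3) by (simp add: field_simps)
          finally show ?thesis using 4(1) by (simp add: add_divide_distrib)
        qed
        then show ?thesis
          unfolding u_def v_def vec_eq_iff
          by (simp only: vector_add_component vector_minus_component vector_smult_component times_divide_eq_left mult_1_left) simp
      qed
      moreover have "norm ((1 / (t + t')) *s (z + z')) = 1"
        unfolding norm_vector_mult n using 4(3) by (simp add: norm_divide)
      ultimately have "(1 / (t + t')) *s (z + z') \<in> C"
        using chain[OF uv, of "t' / (t + t')"] by metis
      then show ?thesis
        using 4(3) unfolding N_def by blast
    qed (use N n in \<open>auto simp: N_def\<close>)
  qed
  interpret null_cone Q
  proof
    show "Q (c * \<alpha>) (c * \<beta>) (c *s n)" if "Q \<alpha> \<beta> n" for \<alpha> \<beta> n c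
      using that N_scale lin_scale unfolding Q_def by metis
    show "2 * Re (\<alpha> * cnj \<beta>) + (norm n)\<^sup>2 = 0" if Q: "Q \<alpha> \<beta> n" for \<alpha> \<beta> n
    proof -
      obtain z t where *: "N z t" "A z t = \<alpha>" "B z t = \<beta>" "Z z t = n"
        using Q unfolding Q_def by blast
      show ?thesis
        using form[of z t] unfolding * N_norm[OF *(1)] by simp
    qed
    show "Q (\<alpha> + \<alpha>') (\<beta> + \<beta>') (n + n')"
      if Q: "Q \<alpha> \<beta> n" "Q \<alpha>' \<beta>' n'" and 0: "2 * Re ((\<alpha> + \<alpha>') * cnj (\<beta> + \<beta>')) + (norm (n + n'))\<^sup>2 = 0"
      for \<alpha> \<beta> n \<alpha>' \<beta>' n'
    proof -
      obtain z t z' t' where *: "N z t" "A z t = \<alpha>" "B z t = \<beta>" "Z z t = n"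
        "N z' t'" "A z' t' = \<alpha>'" "B z' t' = \<beta>'" "Z z' t' = n'"
        using Q unfolding Q_def by blast
      have "(norm (z + z'))\<^sup>2 - (cmod (t + t'))\<^sup>2 = 0"
        unfolding form lin_add * by (rule 0)
      then have "norm (z + z') = cmod (t + t')" by simp
      then have "N (z + z') (t + t')" by (rule N_add[OF *(1,5)])
      then show ?thesis
        unfolding Q_def *(2-4,6-8)[symmetric] using lin_add[of z z' t t'] by blast
    qed
    have "N x 1" "A x 1 = 1" "B x 1 = 0" "Z x 1 = 0"
      using x g by (simp_all add: N_def A_def B_def Z_def xx xy)
    then show "Q 1 0 0" unfolding Q_def by blast
    let ?t = "1 / cnj g"
    have "N (?t *s y) ?t" "A (?t *s y) ?t = 0" "B (?t *s y) ?t = 1" "Z (?t *s y) ?t = 0"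
      using y g by (simp_all add: N_def A_def B_def Z_def cinner_scale_left xx yx vec_eq_iff field_simps)
    then show "Q 0 1 0" unfolding Q_def by blast
  qed
  define T where "T = {p. Z (fst p) (snd p) \<in> full_normals}"
  have T_scale: "(c *s z, c * t) \<in> T" if "(z, t) \<in> T" for c z t
    using that full_normals_scale by (simp add: T_def lin_scale)
  have "subspace T"
    unfolding subspace_def
  proof (intro conjI ballI allI)
    show "0 \<in> T" using Q_full_normals[OF base(1)] by (simp add: T_def Z_def B_def cinner_def)
    show "p + q \<in> T" if "p \<in> T" "q \<in> T" for p q
      using that full_normals_add by (simp add: T_def lin_add)
    show "r *\<^sub>R p \<in> T" if "p \<in> T" for r p
      using T_scale[of "fst p" "snd p" "of_real r"] that
      by (simp add: scaleR_eq_vector_mult scaleR_prod_def scaleR_conv_of_real[where 'a = complex])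
  qed
  have "T = UNIV"
  proof (rule ccontr)
    assume "T \<noteq> UNIV"
    then have "span T \<noteq> UNIV" using \<open>subspace T\<close> by (metis span_eq_iff)
    then obtain p where p: "p \<noteq> 0" "\<And>q. q \<in> T \<Longrightarrow> p \<bullet> q = 0"
      using span_not_UNIV_orthogonal span_base by metis
    obtain a b where ab: "p = (a, b)" by fastforce
    have "cinner u a = - cnj b" if "u \<in> C" for u
    proof -
      have "N u 1" using that by (simp add: N_def)
      then have "Q (A u 1) (B u 1) (Z u 1)" unfolding Q_def by blast
      then have "(u, 1) \<in> T" using Q_full_normals by (simp add: T_def)
      then have orth: "p \<bullet> (c *s u, c * 1) = 0" for c using T_scale p(2) by blast
      have "Re (c * (cinner u a + cnj b)) = 0" for c
      proof -
        have "Re (c * (cinner u a + cnj b)) = Re (cinner (c *s u) a) + Re (c * cnj b)"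
          by (simp only: distrib_left cinner_scale_left plus_complex.sel)
        also have "\<dots> = p \<bullet> (c *s u, c * 1)"
          by (simp add: ab Re_cinner inner_commute) (simp add: inner_complex_def)
        finally show ?thesis using orth by simp
      qed
      \<comment> \<open>This \<open>c\<close> turns the real orthogonality into the vanishing of a
        squared modulus, so \<open>C\<close> would lie in a complex hyperplane unless a = 0.\<close>
      from this[of "cnj (cinner u a + cnj b)"] have "(cmod (cinner u a + cnj b))\<^sup>2 = 0"
        by (metis Re_complex_of_real complex_norm_square mult.commute)
      then show ?thesis by (simp add: add_eq_0_iff)
    qed
    then have "a = 0" using span by metis
    moreover have "b = 0" using \<open>a = 0\<close> \<open>\<And>u. u \<in> C \<Longrightarrow> cinner u a = - cnj b\<close>[OF x] by (simp add: cinner_def)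
    ultimately show False using p(1) ab by (simp add: zero_prod_def)
  qed
  then have "(w, 1) \<in> T" by simp
  then have "Z w 1 \<in> full_normals" by (simp add: T_def)
  moreover have "2 * Re (A w 1 * cnj (B w 1)) + (norm (Z w 1))\<^sup>2 = 0"
    using form[of w 1] w by simp
  ultimately have "Q (A w 1) (B w 1) (Z w 1)" unfolding full_normals_def by blast
  then obtain z t where *: "N z t" "A z t = A w 1" "B z t = B w 1" "Z z t = Z w 1"
    unfolding Q_def by blast
  have "A (z + (- 1) *s w) (t + (- 1) * 1) = 0" "B (z + (- 1) *s w) (t + (- 1) * 1) = 0" "Z (z + (- 1) *s w) (t + (- 1) * 1) = 0"
    unfolding lin_add lin_scale * by (simp_all add: vec_eq_iff)
  then have "z + (- 1) *s w = 0 \<and> t + (- 1) * 1 = 0" by (rule inj)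
  then have "z = w" "t = 1" by (simp_all add: vec_eq_iff)
  then show "w \<in> C" using *(1) by (simp add: N_def)
qed

text \<open>Once every point of the sphere is a contact point, \<open>K\<close> lies in all tangent
  half-spaces of the ball; for a point \<open>y\<close> the one at y/|y| already bounds its
  norm.\<close>

lemma maximal_unit_ball_eq:
  fixes K :: "(complex ^ 'n) set"
  assumes "convex K" "disc_sections K" and ball: "cball 0 1 \<subseteq> K"
    and max: "\<And>M b. (\<And>x. x \<in> cball 0 1 \<Longrightarrow> M *v x + b \<in> K) \<Longrightarrow> cmod (det M) \<le> 1"
  shows "K = cball 0 1"
proof (rule antisym[OF subsetI ball])
  fix y assume "y \<in> K"
  show "y \<in> cball 0 1"
  proof (cases "y = 0")
    case False
    define C where "C = {u. norm u = 1 \<and> u \<notin> interior K}"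
    define w where "w = y /\<^sub>R norm y"
    have w: "norm w = 1" using False by (simp add: w_def)
    have "w \<in> C"
    proof (rule chain_closed_spanning_eq_sphere[OF _ _ _ w])
      show "u + s *s (v - u) \<in> C" if "u \<in> C" "v \<in> C" "norm (u + s *s (v - u)) = 1" for u v s
        using contact_points_chain_closed[OF assms(1) ball assms(2)] that by (auto simp: C_def)
      show "\<exists>u\<in>C. cinner u a \<noteq> c" if "a \<noteq> 0" for a c
      proof -
        have "\<exists>u. norm u = 1 \<and> u \<notin> interior K \<and> cinner u a \<noteq> c"
          by (rule maximal_ball_contact_points_span[OF ball _ that]) (rule max)
        then show ?thesis by (auto simp: C_def)
      qed
    qed (auto simp: C_def)
    then have "Re (cinner y w) \<le> 1"
      using contact_point_support[OF assms(1) ball w _ \<open>y \<in> K\<close>] by (simp add: C_def)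
    moreover have "Re (cinner y w) = norm y"
      using False by (simp add: Re_cinner w_def power2_norm_eq_inner[symmetric] power2_eq_square)
    ultimately show ?thesis by simp
  qed simp
qed

theorem theorem4p3:
  fixes K :: "(complex ^ 'n) set"
  assumes "CARD('n) \<ge> 2"
    and "convex_body K"
    and "\<And>H. complex_hyperplane H \<Longrightarrow> circ_symmetric (H \<inter> K)"
  shows "complex_ellipsoid K"
proof -
  have K: "compact K" "convex K" "interior K \<noteq> {}"
    using assms(2) by (auto simp: convex_body_def)
  have disc: "disc_sections K"
    using disc_sections_if_symmetric_hyperplane_sections[OF assms(1) K(1,2) assms(3)] .
  obtain M :: "complex ^ 'n ^ 'n" and b where M: "det M \<noteq> 0" "\<And>x. x \<in> cball 0 1 \<Longrightarrow> M *v x + b \<in> K"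
    "\<And>N c. (\<And>x. x \<in> cball 0 1 \<Longrightarrow> N *v x + c \<in> K) \<Longrightarrow> cmod (det N) \<le> cmod (det M)"
    using exists_maximal_ellipsoid[OF K(1,3)] by blast
  \<comment> \<open>Pulling back along the maximal map makes the unit ball maximal in
    \<open>K'\<close>, because determinants multiply.\<close>
  define K' where "K' = {x. M *v x + b \<in> K}"
  have "K' = cball 0 1"
  proof (rule maximal_unit_ball_eq)
    show "convex K'"
      unfolding convex_def
    proof (intro ballI allI impI)
      fix x y and u v :: real assume *: "x \<in> K'" "y \<in> K'" "0 \<le> u" "0 \<le> v" "u + v = 1"
      have "u *\<^sub>R (M *v x + b) + v *\<^sub>R (M *v y + b) \<in> K"
        using * by (intro convexD[OF K(2)]) (auto simp: K'_def)
      also have "u *\<^sub>R (M *v x + b) + v *\<^sub>R (M *v y + b) = M *v (u *\<^sub>R x + v *\<^sub>R y) + (u + v) *\<^sub>R b"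
        by (simp add: matrix_vector_right_distrib scaleR_eq_vector_mult vector_scalar_commute vec_eq_iff algebra_simps)
      finally show "u *\<^sub>R x + v *\<^sub>R y \<in> K'" using * by (simp add: K'_def)
    qed
    show "disc_sections K'"
      unfolding disc_sections_def
    proof (intro allI)
      fix p d
      have line: "M *v (p + s *s d) + b = (M *v p + b) + s *s (M *v d)" for s
        by (simp add: matrix_vector_right_distrib vector_scalar_commute)
      show "\<exists>c. \<forall>s \<xi>. cmod \<xi> = 1 \<longrightarrow> p + s *s d \<in> K' \<longrightarrow> p + (c + \<xi> * (s - c)) *s d \<in> K'"
        unfolding K'_def mem_Collect_eq line using disc unfolding disc_sections_def by blast
    qed
    show "cball 0 1 \<subseteq> K'" using M(2) by (auto simp: K'_def)
    show "cmod (det N) \<le> 1" if N: "\<And>x. x \<in> cball 0 1 \<Longrightarrow> N *v x + c \<in> K'" for N c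
    proof -
      have "cmod (det (M ** N)) \<le> cmod (det M)"
      proof (rule M(3)[of _ "M *v c + b"])
        fix x :: "complex ^ 'n" assume "x \<in> cball 0 1"
        then have "M *v (N *v x + c) + b \<in> K" using N by (simp add: K'_def)
        then show "(M ** N) *v x + (M *v c + b) \<in> K"
          by (simp add: matrix_vector_right_distrib matrix_vector_mul_assoc add.assoc)
      qed
      then show ?thesis using M(1) by (simp add: det_mul norm_mult)
    qed
  qed
  have inv: "invertible M" using M(1) by (simp add: invertible_det_nz)
  then obtain M' where M': "M ** M' = mat 1" unfolding invertible_def by blast
  have "K = (\<lambda>x. M *v x + b) ` K'"
  proof (intro equalityI subsetI)
    fix y assume "y \<in> K"
    moreover have "M *v (M' *v (y - b)) + b = y"
      by (simp add: matrix_vector_mul_assoc M')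
    ultimately show "y \<in> (\<lambda>x. M *v x + b) ` K'"
      by (intro image_eqI[of _ _ "M' *v (y - b)"]) (auto simp: K'_def)
  qed (auto simp: K'_def)
  then show ?thesis
    unfolding complex_ellipsoid_def using inv \<open>K' = cball 0 1\<close> by blast
qed

end
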